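(* Let $r > 1$. Let $X_1, X_2, \dots$ be i.i.d. centered random vectors in $\mathbb{R}^d$ with finite covariance matrix, and let $\rho_n$ denote the density of the normalized sum $Z_n = \frac{X_1 + \cdots + X_n}{\sqrt{n}}$. The following statements are equivalent. 1. $h_r(Z_n) \to h_r(Z)$ as $n \to +\infty$, where $Z$ is a Gaussian random vector with mean $0$ and the same covariance matrix as $X_1$. 2. $h_r(Z_{n_0})$ is finite for some integer $n_0$. 3. $\int_{\mathbb{R}^d} |\varphi_{X_1}(t)|^{\nu}\,dt < +\infty$ for some $\nu \geq 1$. 4. $Z_{n_0}$ has a bounded density $\rho_{n_0}$ for some integer $n_0$.
   Context: For a random vector $X$ in $\mathbb{R}^d$ with density $f$ with respect to Lebesgue measure and $r \in (0,1)\cup(1,\infty)$, the $r$-R\'enyi entropy is $h_r(X) = \frac{1}{1-r}\log \int_{\mathbb{R}^d} f(x)^r\,dx$. The characteristic function of $X$ is $\varphi_X(t) = \mathbb{E}[e^{i\langle t, X\rangle}]$, $t\in\mathbb{R}^d$. *)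

theory Defs
  imports "HOL-Probability.Probability"
begin

definition has_density :: "'a measure \<Rightarrow> ('a \<Rightarrow> 'b::euclidean_space) \<Rightarrow> bool" where
  "has_density M X \<longleftrightarrow> (\<exists>f. distributed M lborel X f)"

definition ereal_log :: "ennreal \<Rightarrow> ereal" where
  "ereal_log x = (if x = 0 then -\<infinity> else if x = top then \<infinity> else ereal (ln (enn2real x)))"

(* The density is taken to be the Radon-Nikodym derivative of the law of X with respect to
   Lebesgue measure, so the value is meaningful only if has_density M X holds. Densities are
   finite almost everywhere, so enn2real loses nothing. The entropy may be infinite. *)
definition renyi_entropy :: "real \<Rightarrow> 'a measure \<Rightarrow> ('a \<Rightarrow> 'b::euclidean_space) \<Rightarrow> ereal" where
  "renyi_entropy r M X =
     ereal (1 / (1 - r)) *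
     ereal_log (\<integral>\<^sup>+x. ennreal (enn2real (RN_deriv lborel (distr M lborel X) x) powr r) \<partial>lborel)"

definition char_fun :: "'a measure \<Rightarrow> ('a \<Rightarrow> 'b::euclidean_space) \<Rightarrow> 'b \<Rightarrow> complex" where
  "char_fun M X t = (CLINT \<omega>|M. iexp (t \<bullet> X \<omega>))"

definition covariance_matrix :: "'a measure \<Rightarrow> ('a \<Rightarrow> real ^ 'd) \<Rightarrow> real ^ 'd ^ 'd" where
  "covariance_matrix M X =
     (\<chi> i j. LINT \<omega>|M. (X \<omega> $ i - (LINT \<omega>|M. X \<omega> $ i)) * (X \<omega> $ j - (LINT \<omega>|M. X \<omega> $ j)))"

(* Guards against Bochner integrals that are 0 by default. *)
definition finite_covariance :: "'a measure \<Rightarrow> ('a \<Rightarrow> real ^ 'd) \<Rightarrow> bool" where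
  "finite_covariance M X \<longleftrightarrow>
     (\<forall>i j. integrable M
       (\<lambda>\<omega>. (X \<omega> $ i - (LINT \<omega>|M. X \<omega> $ i)) * (X \<omega> $ j - (LINT \<omega>|M. X \<omega> $ j))))"

definition centered :: "'a measure \<Rightarrow> ('a \<Rightarrow> real ^ 'd) \<Rightarrow> bool" where
  "centered M X \<longleftrightarrow> integrable M X \<and> (LINT \<omega>|M. X \<omega>) = 0"

(* Every linear functional of Z is normal; variance 0 (a point mass) is admitted, so the
   covariance matrix of a Gaussian vector may be singular. *)
definition gaussian_vector :: "'a measure \<Rightarrow> ('a \<Rightarrow> 'b::euclidean_space) \<Rightarrow> bool" where
  "gaussian_vector M Z \<longleftrightarrow>
     Z \<in> borel_measurable M \<and>
     (\<forall>t. \<exists>\<mu> \<sigma>. \<sigma> \<ge> 0 \<and>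
        distr M borel (\<lambda>\<omega>. t \<bullet> Z \<omega>) =
          (if \<sigma> = 0 then return borel \<mu> else density lborel (\<lambda>x. ennreal (normal_density \<mu> \<sigma> x))))"

definition normalized_sum :: "(nat \<Rightarrow> 'a \<Rightarrow> 'b::euclidean_space) \<Rightarrow> nat \<Rightarrow> 'a \<Rightarrow> 'b" where
  "normalized_sum X n \<omega> = (\<Sum>i=1..n. X i \<omega>) /\<^sub>R sqrt (real n)"

end

theory Submission
  imports Defs "HOL-Real_Asymp.Real_Asymp"
begin

text \<open>
  Number the four conditions: (1) the entropies converge, (2) one entropy is finite, (3) a power of
  the characteristic function \<open>\<phi>\<close> of \<open>X 1\<close> is integrable, (4) one normalized sum has a bounded density.
  The implications proved are \<open>4 \<Longrightarrow> 2 \<Longrightarrow> 3 \<Longrightarrow> 1 \<and> 4\<close> and \<open>1 \<Longrightarrow> 2\<close>.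

  \<open>4 \<Longrightarrow> 2\<close> holds because a density bounded by \<open>C\<close> satisfies \<open>0 < \<integral>f\<^sup>r \<le> C\<^bsup>r-1\<^esup>\<close>
  (\<open>bounded_density_entropy\<close>).

  \<open>2 \<Longrightarrow> 3\<close>. A finite entropy means \<open>\<integral>f\<^sup>r < \<infinity>\<close> for the density \<open>f\<close> of a normalized sum. When \<open>r < 2\<close>
  this is too weak for Plancherel, so take \<open>k\<close> independent copies. The event that their sum lies in
  \<open>A\<close> splits according to whether some copy sits where \<open>f \<le> T\<close>; conditioning on the other copies
  bounds the first part by \<open>k T \<bar>A\<bar>\<close>, with \<open>\<bar>A\<bar>\<close> the Lebesgue measure, while the second part has probability at most
  \<open>(T\<^bsup>1-r\<^esup> \<integral>f\<^sup>r)\<^sup>k\<close> (\<open>iid_sum_concentration\<close>). If \<open>k (r - 1) > 1\<close>, then letting \<open>T\<close> run through the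
  powers of 2 shows that the sum has a square integrable density
  (\<open>square_integrable_density_of_concentration\<close>), hence a square integrable characteristic function
  (\<open>cfun_square_integrable\<close>), and that function is a power of a rescaled \<open>\<phi>\<close>.

  \<open>3 \<Longrightarrow> 1 \<and> 4\<close>. For large \<open>n\<close> the characteristic function \<open>\<phi>(t/\<surd>n)\<^sup>n\<close> of the normalized sum is integrable,
  so Fourier inversion (\<open>fourier_inversion\<close>) gives a bounded density; this is (4). For (1) it is enough
  that \<open>\<phi>(t/\<surd>n)\<^sup>n\<close> converges in mean to the Gaussian characteristic function (\<open>local_limit_L1\<close>): then
  the densities converge uniformly, by Scheffe's lemma also in mean, and the integrals of their
  \<open>r\<close>-th powers converge (\<open>power_integral_tendsto\<close>). Pointwise convergence is the central limit
  theorem along a line. A dominating function comes from (3): an integrable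
  power of the Lipschitz function \<open>\<phi>\<close> forces \<open>\<bar>\<phi>\<bar> \<le> 1/2\<close> outside a ball
  (\<open>cfun_small_at_infinity\<close>), and the inequality \<open>1 - \<bar>\<phi>(2t)\<bar> \<le> 4 (1 - \<bar>\<phi>(t)\<bar>)\<close> carries this
  bound towards the origin, where it becomes \<open>\<bar>\<phi>(t)\<bar> \<le> exp (-c \<bar>t\<bar>\<^sup>2)\<close> (\<open>cfun_gaussian_bound\<close>). So the
  covariance matrix is nonsingular automatically.

  \<open>1 \<Longrightarrow> 2\<close>. A Gaussian vector with a density does not live on a hyperplane, so its variance form is
  positive definite, its characteristic function is integrable and its entropy is finite; entropies
  that converge to a finite limit are finite in the end.
\<close>

section \<open>Gaussian kernels and their Fourier transforms\<close>

definition gauss_kernel :: "real \<Rightarrow> 'b::euclidean_space \<Rightarrow> real" where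
  "gauss_kernel s x = (\<Prod>b\<in>Basis. normal_density 0 s (x \<bullet> b))"

text \<open>
  The characteristic function depends on a random vector only through its law, and in this form laws
  without a distinguished random vector can be treated.
\<close>

definition cfun :: "'b::euclidean_space measure \<Rightarrow> 'b \<Rightarrow> complex" where
  "cfun \<mu> t = (CLINT x|\<mu>. iexp (t \<bullet> x))"

lemma gauss_kernel_nonneg [simp]: "0 \<le> gauss_kernel s x"
  unfolding gauss_kernel_def by (intro prod_nonneg) auto

lemma gauss_kernel_measurable [measurable]: "gauss_kernel s \<in> borel_measurable borel"
  unfolding gauss_kernel_def by measurable

lemma gauss_kernel_minus: "gauss_kernel s (- x) = gauss_kernel s x"
  unfolding gauss_kernel_def normal_density_def by simp

lemma gauss_kernel_eq:
  fixes x :: "'b::euclidean_space"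
  assumes "s > 0"
  shows "gauss_kernel s x = (1 / (sqrt (2 * pi) * s)) ^ DIM('b) * exp (- (norm x)\<^sup>2 / (2 * s\<^sup>2))"
proof -
  have "gauss_kernel s x = (\<Prod>b\<in>Basis. (1 / (sqrt (2 * pi) * s)) * exp (- (x \<bullet> b)\<^sup>2 / (2 * s\<^sup>2)))"
    using assms unfolding gauss_kernel_def normal_density_def by (simp add: real_sqrt_mult)
  also have "\<dots> = (1 / (sqrt (2 * pi) * s)) ^ DIM('b) * exp (\<Sum>b\<in>(Basis :: 'b set). - (x \<bullet> b)\<^sup>2 / (2 * s\<^sup>2))"
    by (simp only: prod.distrib prod_constant exp_sum[OF finite_Basis])
  also have "(\<Sum>b\<in>(Basis :: 'b set). - (x \<bullet> b)\<^sup>2 / (2 * s\<^sup>2)) = - (norm x)\<^sup>2 / (2 * s\<^sup>2)"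
    unfolding power2_norm_eq_inner euclidean_inner[of x x]
    by (simp add: sum_divide_distrib sum_negf power2_eq_square)
  finally show ?thesis .
qed

lemma gauss_kernel_le:
  fixes x :: "'b::euclidean_space"
  assumes "s > 0"
  shows "gauss_kernel s x \<le> (1 / (sqrt (2 * pi) * s)) ^ DIM('b)"
  unfolding gauss_kernel_eq[OF assms] using assms by (simp add: divide_le_0_iff mult_left_le)

lemma nn_integral_gauss_kernel:
  assumes "s > 0"
  shows "(\<integral>\<^sup>+x. ennreal (gauss_kernel s (x :: 'b::euclidean_space)) \<partial>lborel) = 1"
proof -
  have "(\<integral>\<^sup>+x. ennreal (gauss_kernel s (x :: 'b)) \<partial>lborel)
      = (\<integral>\<^sup>+x. (\<Prod>b\<in>Basis. ennreal (normal_density 0 s ((x :: 'b) \<bullet> b))) \<partial>lborel)"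
    unfolding gauss_kernel_def by (simp add: prod_ennreal)
  also have "\<dots> = (\<Prod>b\<in>(Basis :: 'b set). (\<integral>\<^sup>+x. ennreal (normal_density 0 s x) \<partial>lborel))"
    by (rule nn_integral_lborel_prod) auto
  also have "\<dots> = 1"
    using assms by (simp add: nn_integral_eq_integral)
  finally show ?thesis .
qed

lemma integrable_gauss_kernel [intro]:
  "s > 0 \<Longrightarrow> integrable lborel (gauss_kernel s)"
  by (rule integrableI_nn_integral_finite[where x = 1]) (simp_all add: nn_integral_gauss_kernel)

lemma integral_gauss_kernel:
  "s > 0 \<Longrightarrow> (LINT x|lborel. gauss_kernel s (x :: 'b::euclidean_space)) = 1"
  by (subst integral_eq_nn_integral) (simp_all add: nn_integral_gauss_kernel)

text \<open>Lebesgue measure is the image of a product measure, so Fubini applies coordinate by coordinate;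
  this reduces the Fourier transform of the Gaussian kernel to dimension one.\<close>

lemma integral_lborel_prod:
  fixes f :: "'b::euclidean_space \<Rightarrow> real \<Rightarrow> complex"
  assumes "\<And>b. b \<in> Basis \<Longrightarrow> integrable lborel (f b)"
  shows "(CLINT x|lborel. (\<Prod>b\<in>Basis. f b (x \<bullet> b))) = (\<Prod>b\<in>Basis. CLINT x|lborel. f b x)"
proof -
  interpret product_sigma_finite "\<lambda>_ :: 'b. lborel :: real measure" ..
  have [measurable]: "f b \<in> borel_measurable borel" if "b \<in> Basis" for b
    using borel_measurable_integrable[OF assms[OF that]] by simp
  have "(CLINT x|lborel. (\<Prod>b\<in>Basis. f b (x \<bullet> b)))
     = (CLINT x|(\<Pi>\<^sub>M b\<in>(Basis :: 'b set). lborel). (\<Prod>b\<in>Basis. f b ((\<Sum>b\<in>Basis. x b *\<^sub>R b) \<bullet> b)))"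
    by (subst lborel_eq) (rule integral_distr; measurable)
  also have "\<dots> = (CLINT x|(\<Pi>\<^sub>M b\<in>(Basis :: 'b set). lborel). (\<Prod>b\<in>Basis. f b (x b)))"
    by (simp add: inner_sum_left inner_Basis if_distrib sum.delta cong: if_cong)
  also have "\<dots> = (\<Prod>b\<in>Basis. CLINT x|lborel. f b x)"
    using assms by (intro product_integral_prod) auto
  finally show ?thesis .
qed

text \<open>The substitution \<open>x \<mapsto> x / s\<close> reduces this to the standard normal distribution.\<close>

lemma normal_density_fourier:
  assumes s: "s > 0"
  shows "(CLINT x|lborel. complex_of_real (normal_density 0 s x) * iexp (a * x)) = exp (- (s * a)\<^sup>2 / 2)"
proof -
  have "complex_of_real (exp (- (s * a)\<^sup>2 / 2)) = char std_normal_distribution (s * a)"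
    by (simp add: char_std_normal_distribution)
  also have "\<dots> = (CLINT x|lborel. std_normal_density x *\<^sub>R iexp (s * a * x))"
    unfolding char_def by (subst integral_density) auto
  also have "\<dots> = (CLINT x|lborel. complex_of_real (std_normal_density x) * iexp (s * a * x))"
    by (simp add: scaleR_conv_of_real)
  also have "\<dots> = \<bar>1 / s\<bar> *\<^sub>R (CLINT x|lborel.
      complex_of_real (std_normal_density (0 + (1 / s) * x)) * iexp (s * a * (0 + (1 / s) * x)))"
    using s by (intro lborel_integral_real_affine) auto
  also have "\<dots> = (CLINT x|lborel. \<bar>1 / s\<bar> *\<^sub>R
      (complex_of_real (std_normal_density (0 + (1 / s) * x)) * iexp (s * a * (0 + (1 / s) * x))))"
    by (rule integral_scaleR_right[symmetric])
  also have "\<dots> = (CLINT x|lborel. complex_of_real (normal_density 0 s x) * iexp (a * x))"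
    using s by (intro Bochner_Integration.integral_cong)
       (auto simp: normal_density_def real_sqrt_mult power_divide scaleR_conv_of_real mult_ac)
  finally show ?thesis by simp
qed

lemma gauss_kernel_fourier:
  fixes t :: "'b::euclidean_space"
  assumes s: "s > 0"
  shows "(CLINT x|lborel. complex_of_real (gauss_kernel s x) * iexp (t \<bullet> x)) = exp (- (s * norm t)\<^sup>2 / 2)"
proof -
  have "complex_of_real (gauss_kernel s x) * iexp (t \<bullet> x)
     = (\<Prod>b\<in>Basis. complex_of_real (normal_density 0 s (x \<bullet> b)) * iexp ((t \<bullet> b) * (x \<bullet> b)))" for x
    unfolding gauss_kernel_def euclidean_inner[of t x]
    by (simp add: prod.distrib exp_sum sum_distrib_left)
  then have "(CLINT x|lborel. complex_of_real (gauss_kernel s x) * iexp (t \<bullet> x))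
     = (CLINT x|lborel. (\<Prod>b\<in>Basis. complex_of_real (normal_density 0 s (x \<bullet> b)) * iexp ((t \<bullet> b) * (x \<bullet> b))))"
    by simp
  also have "\<dots> = (\<Prod>b\<in>Basis. CLINT x|lborel. complex_of_real (normal_density 0 s x) * iexp ((t \<bullet> b) * x))"
  proof (rule integral_lborel_prod)
    fix b :: 'b
    show "integrable lborel (\<lambda>x. complex_of_real (normal_density 0 s x) * iexp ((t \<bullet> b) * x))"
      by (rule Bochner_Integration.integrable_bound[OF integrable_normal_density[OF s, of 0]])
         (auto simp: norm_mult)
  qed
  also have "\<dots> = (\<Prod>b\<in>Basis. complex_of_real (exp (- (s * (t \<bullet> b))\<^sup>2 / 2)))"
    by (simp only: normal_density_fourier[OF s])
  also have "\<dots> = complex_of_real (exp (\<Sum>b\<in>Basis. - (s * (t \<bullet> b))\<^sup>2 / 2))"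
    by (simp only: exp_sum[OF finite_Basis] of_real_prod)
  also have "(\<Sum>b\<in>Basis. - (s * (t \<bullet> b))\<^sup>2 / 2) = - (s * norm t)\<^sup>2 / 2"
    unfolding power_mult_distrib power2_norm_eq_inner euclidean_inner[of t t]
    by (simp add: sum_divide_distrib sum_negf sum_distrib_left power2_eq_square)
  finally show ?thesis .
qed

text \<open>Up to a constant the Fourier transform of a Gaussian kernel is again a Gaussian kernel, so that
  applying the transform twice inverts it.\<close>

lemma exp_eq_gauss_kernel:
  fixes t :: "'b::euclidean_space"
  assumes s: "s > 0"
  shows "exp (- (s * norm t)\<^sup>2 / 2) = (sqrt (2 * pi) / s) ^ DIM('b) * gauss_kernel (1 / s) t"
  using s by (simp add: gauss_kernel_eq power_divide field_simps power_mult_distrib)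

lemma integrable_gauss_exp:
  "s > 0 \<Longrightarrow> integrable lborel (\<lambda>t :: 'b::euclidean_space. exp (- (s * norm t)\<^sup>2 / 2))"
  unfolding exp_eq_gauss_kernel by (intro integrable_mult_right integrable_gauss_kernel) auto

lemma gauss_kernel_inverse_fourier:
  fixes x :: "'b::euclidean_space"
  assumes s: "s > 0"
  shows "(CLINT t|lborel. complex_of_real (exp (- (s * norm t)\<^sup>2 / 2)) * iexp (x \<bullet> t))
    = (2 * pi) ^ DIM('b) * gauss_kernel s x"
proof -
  have "(CLINT t|lborel. complex_of_real (exp (- (s * norm t)\<^sup>2 / 2)) * iexp (x \<bullet> t))
     = (CLINT t|lborel. complex_of_real ((sqrt (2 * pi) / s) ^ DIM('b)) *
         (complex_of_real (gauss_kernel (1 / s) t) * iexp (x \<bullet> t)))"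
    unfolding exp_eq_gauss_kernel[OF s] by (simp only: of_real_mult mult.assoc)
  also have "\<dots> = complex_of_real ((sqrt (2 * pi) / s) ^ DIM('b)) * exp (- ((1 / s) * norm x)\<^sup>2 / 2)"
    using s by (simp only: integral_mult_right_zero) (subst gauss_kernel_fourier; simp)
  also have "\<dots> = complex_of_real ((sqrt (2 * pi) / s) ^ DIM('b) * exp (- (norm x)\<^sup>2 / (2 * s\<^sup>2)))"
    by (simp add: power_divide mult.commute)
  also have "(sqrt (2 * pi) / s) ^ DIM('b) * exp (- (norm x)\<^sup>2 / (2 * s\<^sup>2))
     = (2 * pi) ^ DIM('b) * gauss_kernel s x"
  proof -
    have "sqrt (2 * pi) / s = 2 * pi * (1 / (sqrt (2 * pi) * s))"
      using s by (simp add: field_simps)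
    then show ?thesis
      unfolding gauss_kernel_eq[OF s] by (simp only: power_mult_distrib mult.assoc)
  qed
  finally show ?thesis by simp
qed

section \<open>Smoothing a law by a Gaussian kernel\<close>

text \<open>
  The density of \<open>Y + s G\<close> for a vector \<open>Y\<close> of law \<open>\<mu>\<close> and an independent standard Gaussian vector \<open>G\<close>.
\<close>

definition smooth :: "'b::euclidean_space measure \<Rightarrow> real \<Rightarrow> 'b \<Rightarrow> real" where
  "smooth \<mu> s x = (LINT y|\<mu>. gauss_kernel s (x - y))"

text \<open>Writing the kernel as an inverse Fourier transform and exchanging the two integrals expresses the
  smoothed law through the characteristic function. Both uniqueness and inversion rest on this
  identity; the Gaussian factor makes all integrals absolutely convergent.\<close>

lemma smooth_fourier:
  fixes \<mu> :: "'b::euclidean_space measure"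
  assumes "prob_space \<mu>" and [measurable_cong]: "sets \<mu> = sets borel" and s: "s > 0"
  shows "(2 * pi) ^ DIM('b) * complex_of_real (smooth \<mu> s x)
    = (CLINT t|lborel. exp (- (s * norm t)\<^sup>2 / 2) * (iexp (- (t \<bullet> x)) * cfun \<mu> t))"
proof -
  interpret prob_space \<mu> by fact
  interpret P: pair_sigma_finite lborel \<mu> ..
  have int: "integrable (lborel \<Otimes>\<^sub>M \<mu>)
      (\<lambda>(t, y). complex_of_real (exp (- (s * norm t)\<^sup>2 / 2)) * iexp (t \<bullet> (y - x)))"
  proof (rule P.Fubini_integrable)
    show "(\<lambda>(t, y). complex_of_real (exp (- (s * norm t)\<^sup>2 / 2)) * iexp (t \<bullet> (y - x))) \<in> borel_measurable (lborel \<Otimes>\<^sub>M \<mu>)"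
      by measurable
    show "integrable lborel (\<lambda>t. \<integral>y. norm (case (t, y) of (t, y) \<Rightarrow>
        complex_of_real (exp (- (s * norm t)\<^sup>2 / 2)) * iexp (t \<bullet> (y - x))) \<partial>\<mu>)"
      using integrable_gauss_exp[OF s, where 'b = 'b] by (simp add: norm_mult prob_space)
    show "AE t in lborel. integrable \<mu> (\<lambda>y. case (t, y) of (t, y) \<Rightarrow>
        complex_of_real (exp (- (s * norm t)\<^sup>2 / 2)) * iexp (t \<bullet> (y - x)))"
      by (intro AE_I2, simp only: split, intro integrable_mult_right integrable_const_bound[where B = 1]) auto
  qed
  have "(2 * pi) ^ DIM('b) * complex_of_real (smooth \<mu> s x)
      = (CLINT y|\<mu>. complex_of_real ((2 * pi) ^ DIM('b) * gauss_kernel s (y - x)))"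
    unfolding smooth_def integral_complex_of_real using gauss_kernel_minus[of s "y - x" for y]
    by simp
  also have "\<dots> = (CLINT y|\<mu>. (CLINT t|lborel. complex_of_real (exp (- (s * norm t)\<^sup>2 / 2)) * iexp (t \<bullet> (y - x))))"
    by (simp only: gauss_kernel_inverse_fourier[OF s, where 'b = 'b, symmetric] inner_commute)
  also have "\<dots> = (CLINT t|lborel. (CLINT y|\<mu>. complex_of_real (exp (- (s * norm t)\<^sup>2 / 2)) * iexp (t \<bullet> (y - x))))"
    by (rule P.Fubini_integral[OF int])
  also have "\<dots> = (CLINT t|lborel. exp (- (s * norm t)\<^sup>2 / 2) * (iexp (- (t \<bullet> x)) * cfun \<mu> t))"
  proof (rule Bochner_Integration.integral_cong[OF refl])
    fix t
    have "iexp (t \<bullet> (y - x)) = iexp (- (t \<bullet> x)) * iexp (t \<bullet> y)" for y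
      by (simp add: inner_diff_right exp_diff exp_minus field_simps)
    then show "(CLINT y|\<mu>. complex_of_real (exp (- (s * norm t)\<^sup>2 / 2)) * iexp (t \<bullet> (y - x)))
       = exp (- (s * norm t)\<^sup>2 / 2) * (iexp (- (t \<bullet> x)) * cfun \<mu> t)"
      unfolding cfun_def by (simp only: integral_mult_right_zero)
  qed
  finally show ?thesis .
qed

lemma smooth_nonneg: "0 \<le> smooth \<mu> s x"
  unfolding smooth_def by (intro Bochner_Integration.integral_nonneg) auto

lemma integral_shift_gauss_kernel:
  fixes h :: "'b::euclidean_space \<Rightarrow> real"
  assumes s: "s > 0" and [measurable]: "h \<in> borel_measurable borel"
  shows "(LINT x|lborel. h x * gauss_kernel s (x - y)) = (LINT z|lborel. h (y + s *\<^sub>R z) * gauss_kernel 1 z)"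
proof -
  have ker: "s ^ DIM('b) * gauss_kernel s (s *\<^sub>R z) = gauss_kernel 1 z" for z :: 'b
    using s by (simp add: gauss_kernel_eq power_mult_distrib power_divide field_simps)
  have "(LINT x|lborel. h x * gauss_kernel s (x - y))
     = (LINT x|density (distr lborel borel (\<lambda>z. y + s *\<^sub>R z)) (\<lambda>_. ennreal (\<bar>s\<bar> ^ DIM('b))). h x * gauss_kernel s (x - y))"
    using s by (subst lborel_affine[of s y]) (auto simp: ennreal_power)
  also have "\<dots> = (LINT z|lborel. \<bar>s\<bar> ^ DIM('b) * (h (y + s *\<^sub>R z) * gauss_kernel s (s *\<^sub>R z)))"
    by (subst integral_density) (auto simp: integral_distr)
  also have "\<dots> = (LINT z|lborel. h (y + s *\<^sub>R z) * gauss_kernel 1 z)"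
    using s by (intro Bochner_Integration.integral_cong) (auto simp: ker[symmetric])
  finally show ?thesis .
qed

text \<open>The kernel is symmetric, so smoothing the law is the same as smoothing the test function.\<close>

lemma smooth_test_integral:
  fixes \<mu> :: "'b::euclidean_space measure" and h :: "'b \<Rightarrow> real"
  assumes "prob_space \<mu>" and [measurable_cong]: "sets \<mu> = sets borel" and s: "s > 0"
    and [measurable]: "h \<in> borel_measurable borel" and h: "\<And>x. \<bar>h x\<bar> \<le> 1"
  shows "(LINT x|lborel. h x * smooth \<mu> s x) = (LINT y|\<mu>. LINT z|lborel. h (y + s *\<^sub>R z) * gauss_kernel 1 z)"
proof -
  interpret prob_space \<mu> by fact
  interpret P: pair_sigma_finite \<mu> lborel ..
  have int_shift: "integrable lborel (\<lambda>x. gauss_kernel s (x - y))" for y :: 'b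
  proof (rule integrableI_nn_integral_finite[where x = 1])
    have "(\<integral>\<^sup>+x. ennreal (gauss_kernel s (x - y)) \<partial>lborel)
       = (\<integral>\<^sup>+x. ennreal (gauss_kernel s (x - y)) \<partial>distr lborel borel ((+) y))"
      by (simp add: lborel_distr_plus)
    also have "\<dots> = 1"
      by (subst nn_integral_distr) (simp_all add: nn_integral_gauss_kernel s)
    finally show "(\<integral>\<^sup>+x. ennreal (gauss_kernel s (x - y)) \<partial>lborel) = ennreal 1" by simp
  qed auto
  have one: "(LINT x|lborel. gauss_kernel s (x - y)) = 1" for y :: 'b
    using integral_shift_gauss_kernel[OF s, of "\<lambda>_. 1" y] integral_gauss_kernel[of 1, where 'b = 'b] by simp
  have bnd: "norm (h x * gauss_kernel s (x - y)) \<le> gauss_kernel s (x - y)" for x y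
    using h[of x] by (simp add: abs_mult mult_left_le_one_le)
  have int: "integrable (\<mu> \<Otimes>\<^sub>M lborel) (\<lambda>(y, x). gauss_kernel s (x - y))"
  proof (rule P.Fubini_integrable)
    show "(\<lambda>(y, x). gauss_kernel s (x - y)) \<in> borel_measurable (\<mu> \<Otimes>\<^sub>M lborel)" by measurable
    show "AE y in \<mu>. integrable lborel (\<lambda>x. case (y, x) of (y, x) \<Rightarrow> gauss_kernel s (x - y))"
      using int_shift by simp
    show "integrable \<mu> (\<lambda>y. \<integral>x. norm (case (y, x) of (y, x) \<Rightarrow> gauss_kernel s (x - y)) \<partial>lborel)"
      by (simp add: one)
  qed
  have int': "integrable (\<mu> \<Otimes>\<^sub>M lborel) (\<lambda>(y, x). h x * gauss_kernel s (x - y))"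
    by (rule Bochner_Integration.integrable_bound[OF int]) (measurable, auto simp: bnd[simplified])
  have "(LINT x|lborel. h x * smooth \<mu> s x) = (LINT x|lborel. LINT y|\<mu>. h x * gauss_kernel s (x - y))"
    unfolding smooth_def by simp
  also have "\<dots> = (LINT y|\<mu>. LINT x|lborel. h x * gauss_kernel s (x - y))"
    by (rule P.Fubini_integral[OF int'])
  finally show ?thesis by (simp add: integral_shift_gauss_kernel[OF s])
qed

text \<open>As the width of the kernel tends to 0, the smoothed test function tends pointwise to the test
  function.\<close>

lemma smooth_tendsto:
  fixes \<mu> :: "'b::euclidean_space measure" and h :: "'b \<Rightarrow> real"
  assumes "prob_space \<mu>" and [measurable_cong]: "sets \<mu> = sets borel"
    and cont: "continuous_on UNIV h" and h: "\<And>x. \<bar>h x\<bar> \<le> 1"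
  shows "(\<lambda>n. LINT x|lborel. h x * smooth \<mu> (1 / Suc n) x) \<longlonglongrightarrow> (LINT y|\<mu>. h y)"
proof -
  interpret prob_space \<mu> by fact
  have [measurable]: "h \<in> borel_measurable borel"
    using cont by (rule borel_measurable_continuous_onI)
  have lim0: "(\<lambda>n. 1 / real (Suc n)) \<longlonglongrightarrow> 0" by (rule LIMSEQ_Suc[OF lim_1_over_n])
  have bnd: "\<bar>h x * gauss_kernel 1 z\<bar> \<le> gauss_kernel 1 z" for x z :: 'b
    using h[of x] by (simp add: abs_mult mult_left_le_one_le)
  have inner_lim: "(\<lambda>n. LINT z|lborel. h (y + (1 / real (Suc n)) *\<^sub>R z) * gauss_kernel 1 z) \<longlonglongrightarrow> h y" for y
  proof -
    have "(\<lambda>n. LINT z|lborel. h (y + (1 / real (Suc n)) *\<^sub>R z) * gauss_kernel 1 z)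
        \<longlonglongrightarrow> (LINT z|lborel. h y * gauss_kernel 1 (z :: 'b))"
    proof (rule integral_dominated_convergence[where w = "\<lambda>z :: 'b. gauss_kernel 1 z"])
      show "AE z in lborel. (\<lambda>n. h (y + (1 / real (Suc n)) *\<^sub>R z) * gauss_kernel 1 z) \<longlonglongrightarrow> h y * gauss_kernel 1 z"
      proof (intro AE_I2 tendsto_mult tendsto_const)
        fix z :: 'b
        have "(\<lambda>n. y + (1 / real (Suc n)) *\<^sub>R z) \<longlonglongrightarrow> y + 0 *\<^sub>R z"
          by (intro tendsto_intros lim0)
        then show "(\<lambda>n. h (y + (1 / real (Suc n)) *\<^sub>R z)) \<longlonglongrightarrow> h y"
          using continuous_on_tendsto_compose[OF cont, of _ y sequentially] by simp
      qed
    qed (auto simp: bnd)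
    then show ?thesis by (simp add: integral_gauss_kernel)
  qed
  have le1: "\<bar>LINT z|lborel. h (y + a *\<^sub>R z) * gauss_kernel 1 z\<bar> \<le> 1" for y and a :: real
  proof -
    have "\<bar>LINT z|lborel. h (y + a *\<^sub>R z) * gauss_kernel 1 z\<bar> \<le> (LINT z|lborel. gauss_kernel 1 (z :: 'b))"
      unfolding real_norm_def[symmetric]
      by (rule Bochner_Integration.integral_norm_bound_integral)
        (auto intro!: Bochner_Integration.integrable_bound[OF integrable_gauss_kernel[of 1]] simp: bnd)
    then show ?thesis by (simp add: integral_gauss_kernel)
  qed
  have "(\<lambda>n. LINT y|\<mu>. LINT z|lborel. h (y + (1 / real (Suc n)) *\<^sub>R z) * gauss_kernel 1 z) \<longlonglongrightarrow> (LINT y|\<mu>. h y)"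
    by (rule integral_dominated_convergence[where w = "\<lambda>_. 1"]) (auto simp: inner_lim le1 simp del: of_nat_Suc)
  then show ?thesis
    by (subst smooth_test_integral[OF assms(1,2)]) (auto simp: h)
qed

text \<open>The indicator of an open box is an increasing limit of continuous functions supported in the box,
  and the open boxes form an intersection-stable generator.\<close>

lemma measure_eq_if_test_integrals_eq:
  fixes \<mu> \<nu> :: "'b::euclidean_space measure"
  assumes "prob_space \<mu>" and sets_mu [measurable_cong]: "sets \<mu> = sets borel"
    and sets_nu [measurable_cong]: "sets \<nu> = sets borel"
    and eq: "\<And>h :: 'b \<Rightarrow> real. continuous_on UNIV h \<Longrightarrow> (\<And>x. 0 \<le> h x \<and> h x \<le> 1) \<Longrightarrow> bounded {x. h x \<noteq> 0} \<Longrightarrow>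
      (\<integral>\<^sup>+x. ennreal (h x) \<partial>\<mu>) = (\<integral>\<^sup>+x. ennreal (h x) \<partial>\<nu>)"
  shows "\<mu> = \<nu>"
proof (rule measure_eqI_generator_eq)
  interpret prob_space \<mu> by fact
  let ?E = "range (\<lambda>(a, b). box a b :: 'b set)"
  show "Int_stable ?E"
    by (auto simp: Int_stable_def box_Int_box)
  show "?E \<subseteq> Pow UNIV" by simp
  show "sets \<mu> = sigma_sets UNIV ?E" "sets \<nu> = sigma_sets UNIV ?E"
    by (simp_all add: borel_eq_box sets_mu sets_nu)
  show "range (\<lambda>n::nat. box (- real n *\<^sub>R One) (real n *\<^sub>R One) :: 'b set) \<subseteq> ?E" by auto
  show "(\<Union>n. box (- real n *\<^sub>R One) (real n *\<^sub>R One) :: 'b set) = UNIV"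
    using UN_box_eq_UNIV by auto
  show "emeasure \<mu> (box (- real n *\<^sub>R One) (real n *\<^sub>R One)) \<noteq> \<infinity>" for n :: nat
    by simp
  fix U assume "U \<in> ?E"
  then obtain a b where U: "U = box a b" by auto
  \<comment> \<open>These functions vanish outside \<open>U\<close> and increase to its indicator, because \<open>U\<close> is open.\<close>
  define h where "h n x = min 1 (real n * infdist x (- U))" for n :: nat and x :: 'b
  have ne: "- U \<noteq> {}" unfolding U using bounded_box[of a b] not_bounded_UNIV[where 'a = 'b]
    by (metis Compl_UNIV_eq double_compl)
  have cl: "closed (- U)" unfolding U by (simp add: open_box closed_Compl)
  have h0: "h n x = 0" if "x \<notin> U" for n x using that by (simp add: h_def)
  have h_range: "0 \<le> h n x \<and> h n x \<le> 1" for n x by (simp add: h_def infdist_nonneg)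
  have h_cont: "continuous_on UNIV (h n)" for n unfolding h_def
    by (intro continuous_intros continuous_on_infdist)
  have [measurable]: "h n \<in> borel_measurable borel" for n
    using h_cont by (rule borel_measurable_continuous_onI)
  have h_inc: "incseq (\<lambda>n x. ennreal (h n x))"
    unfolding h_def incseq_def le_fun_def
    by (auto intro!: ennreal_leI min.mono mult_right_mono infdist_nonneg)
  have h_sup: "(SUP n. ennreal (h n x)) = indicator U x" for x
  proof (cases "x \<in> U")
    case True
    then have "infdist x (- U) > 0"
      using in_closed_iff_infdist_zero[OF cl ne, of x] infdist_nonneg[of x "- U"] by force
    then obtain n :: nat where "1 < real n * infdist x (- U)"
      using reals_Archimedean3 by blast
    then have "h n x = 1" by (simp add: h_def)
    then have "(SUP n. ennreal (h n x)) = 1"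
      using h_range[of _ x] by (intro antisym SUP_least SUP_upper2[of n]) (auto simp: ennreal_le_1)
    then show ?thesis using True by simp
  qed (simp add: h0)
  have emeas: "emeasure \<kappa> U = (SUP n. \<integral>\<^sup>+x. ennreal (h n x) \<partial>\<kappa>)" if "sets \<kappa> = sets borel" for \<kappa>
  proof -
    note [measurable_cong] = that
    have "U \<in> sets \<kappa>" by (simp add: that U)
    then have "emeasure \<kappa> U = (\<integral>\<^sup>+x. (SUP n. ennreal (h n x)) \<partial>\<kappa>)"
      by (simp add: h_sup)
    also have "\<dots> = (SUP n. \<integral>\<^sup>+x. ennreal (h n x) \<partial>\<kappa>)"
      by (rule nn_integral_monotone_convergence_SUP[OF h_inc]) measurable
    finally show ?thesis .
  qed
  have bd: "bounded {x. h n x \<noteq> 0}" for n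
    by (rule bounded_subset[OF bounded_box[of a b]]) (use h0 U in auto)
  have "(\<integral>\<^sup>+x. ennreal (h n x) \<partial>\<mu>) = (\<integral>\<^sup>+x. ennreal (h n x) \<partial>\<nu>)" for n
    by (rule eq[OF h_cont h_range bd])
  then show "emeasure \<mu> U = emeasure \<nu> U"
    using emeas[OF sets_mu] emeas[OF sets_nu] by simp
qed

text \<open>Equal characteristic functions give equal smoothed laws for every kernel width, hence equal
  integrals of all bounded continuous functions.\<close>

theorem cfun_unique:
  fixes \<mu> \<nu> :: "'b::euclidean_space measure"
  assumes mu: "prob_space \<mu>" "sets \<mu> = sets borel" and nu: "prob_space \<nu>" "sets \<nu> = sets borel"
    and eq: "\<And>t. cfun \<mu> t = cfun \<nu> t"
  shows "\<mu> = \<nu>"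
proof (rule measure_eq_if_test_integrals_eq[OF mu nu(2)])
  fix h :: "'b \<Rightarrow> real"
  assume cont: "continuous_on UNIV h" and h: "\<And>x. 0 \<le> h x \<and> h x \<le> 1"
  have ab: "\<bar>h x\<bar> \<le> 1" for x using h[of x] by simp
  have [measurable]: "h \<in> borel_measurable borel"
    using cont by (rule borel_measurable_continuous_onI)
  have "complex_of_real (smooth \<mu> s x) = complex_of_real (smooth \<nu> s x)" if "s > 0" for s x
  proof -
    have "(2 * pi) ^ DIM('b) * complex_of_real (smooth \<mu> s x)
        = (2 * pi) ^ DIM('b) * complex_of_real (smooth \<nu> s x)"
      by (simp only: smooth_fourier[OF mu that] smooth_fourier[OF nu that] eq)
    then show ?thesis by simp
  qed
  then have "smooth \<mu> (1 / real (Suc n)) x = smooth \<nu> (1 / real (Suc n)) x" for n x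
    by (metis of_real_eq_iff of_nat_0_less_iff zero_less_Suc zero_less_divide_1_iff)
  then have "(LINT y|\<mu>. h y) = (LINT y|\<nu>. h y)"
    using smooth_tendsto[OF mu cont ab] smooth_tendsto[OF nu cont ab]
    by (simp add: LIMSEQ_unique)
  moreover have "integrable \<kappa> h" if "prob_space \<kappa>" "sets \<kappa> = sets borel" for \<kappa>
    by (rule finite_measure.integrable_const_bound[where B = 1])
      (use that ab in \<open>auto simp: prob_space_def cong: measurable_cong_sets\<close>)
  ultimately show "(\<integral>\<^sup>+x. ennreal (h x) \<partial>\<mu>) = (\<integral>\<^sup>+x. ennreal (h x) \<partial>\<nu>)"
    using mu nu h by (subst (1 2) nn_integral_eq_integral) auto
qed

section \<open>Fourier inversion\<close>

text \<open>
  Taking the real part loses nothing for characteristic functions of laws, whose inverse transforms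
  are limits of the real functions \<open>smooth \<mu> s\<close>.
\<close>

definition inv_fourier :: "('b::euclidean_space \<Rightarrow> complex) \<Rightarrow> 'b \<Rightarrow> real" where
  "inv_fourier \<phi> x = Re (CLINT t|lborel. iexp (- (t \<bullet> x)) * \<phi> t) / (2 * pi) ^ DIM('b)"

lemma inv_fourier_diff_le:
  fixes \<phi> \<psi> :: "'b::euclidean_space \<Rightarrow> complex"
  assumes "integrable lborel \<phi>" "integrable lborel \<psi>"
  shows "\<bar>inv_fourier \<phi> x - inv_fourier \<psi> x\<bar> \<le> (LINT t|lborel. cmod (\<phi> t - \<psi> t)) / (2 * pi) ^ DIM('b)"
proof -
  have [measurable]: "\<phi> \<in> borel_measurable borel" "\<psi> \<in> borel_measurable borel"
    using assms[THEN borel_measurable_integrable] by simp_all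
  have int: "integrable lborel (\<lambda>t. iexp (- (t \<bullet> x)) * f t)" if "integrable lborel f" for f :: "'b \<Rightarrow> complex"
  proof -
    have [measurable]: "f \<in> borel_measurable borel" using borel_measurable_integrable[OF that] by simp
    show ?thesis
      by (rule Bochner_Integration.integrable_bound[OF that]) (auto simp: norm_mult)
  qed
  have "inv_fourier \<phi> x - inv_fourier \<psi> x
     = Re (CLINT t|lborel. iexp (- (t \<bullet> x)) * (\<phi> t - \<psi> t)) / (2 * pi) ^ DIM('b)"
    unfolding inv_fourier_def right_diff_distrib
    by (subst Bochner_Integration.integral_diff[OF int int]) (simp_all add: assms diff_divide_distrib)
  moreover have "cmod (CLINT t|lborel. iexp (- (t \<bullet> x)) * (\<phi> t - \<psi> t)) \<le> (LINT t|lborel. cmod (\<phi> t - \<psi> t))"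
    by (rule Bochner_Integration.integral_norm_bound_integral)
      (auto simp: norm_mult intro!: int[OF Bochner_Integration.integrable_diff, simplified] assms)
  ultimately show ?thesis
    using abs_Re_le_cmod[of "CLINT t|lborel. iexp (- (t \<bullet> x)) * (\<phi> t - \<psi> t)"]
    by (simp add: abs_divide divide_right_mono)
qed

lemma inv_fourier_le:
  assumes "integrable lborel (\<phi> :: 'b::euclidean_space \<Rightarrow> complex)"
  shows "\<bar>inv_fourier \<phi> x\<bar> \<le> (LINT t|lborel. cmod (\<phi> t)) / (2 * pi) ^ DIM('b)"
  using inv_fourier_diff_le[OF assms integrable_zero, of x] by (simp add: inv_fourier_def)

lemma inv_fourier_measurable [measurable]:
  fixes \<phi> :: "'b::euclidean_space \<Rightarrow> complex"
  assumes [measurable]: "\<phi> \<in> borel_measurable borel"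
  shows "inv_fourier \<phi> \<in> borel_measurable borel"
  unfolding inv_fourier_def by measurable

lemma cfun_measurable [measurable]:
  fixes \<mu> :: "'b::euclidean_space measure"
  assumes "prob_space \<mu>" and [measurable_cong]: "sets \<mu> = sets borel"
  shows "cfun \<mu> \<in> borel_measurable borel"
proof -
  interpret prob_space \<mu> by fact
  show ?thesis unfolding cfun_def by measurable
qed

text \<open>If the characteristic function is integrable, then the smoothed densities converge pointwise to the
  inverse transform by dominated convergence, and they share one bound. So the inverse transform is
  nonnegative, and its integral against a test function of bounded support is the limit of the
  smoothed integrals, which is the integral of the test function under the law.\<close>

theorem fourier_inversion:
  fixes \<mu> :: "'b::euclidean_space measure"
  assumes mu: "prob_space \<mu>" "sets \<mu> = sets borel" and int: "integrable lborel (cfun \<mu>)"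
  shows "\<And>x. 0 \<le> inv_fourier (cfun \<mu>) x"
    and "\<mu> = density lborel (\<lambda>x. ennreal (inv_fourier (cfun \<mu>) x))"
proof -
  have [measurable]: "cfun \<mu> \<in> borel_measurable borel" by (rule cfun_measurable[OF mu])
  let ?f = "inv_fourier (cfun \<mu>)"
  define C where "C = (LINT t|lborel. cmod (cfun \<mu> t)) / (2 * pi) ^ DIM('b)"
  define \<phi> where "\<phi> n t = exp (- ((1 / real (Suc n)) * norm t)\<^sup>2 / 2) *\<^sub>R cfun \<mu> t" for n t
  have phi_le: "cmod (\<phi> n t) \<le> cmod (cfun \<mu> t)" for n t
    by (simp add: \<phi>_def mult_left_le_one_le)
  have [measurable]: "\<phi> n \<in> borel_measurable borel" for n unfolding \<phi>_def by measurable
  have phi_int: "integrable lborel (\<phi> n)" for n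
    by (rule Bochner_Integration.integrable_bound[OF int]) (auto simp: phi_le)
  have sm: "smooth \<mu> (1 / real (Suc n)) x = inv_fourier (\<phi> n) x" for n x
  proof -
    have "(2 * pi) ^ DIM('b) * complex_of_real (smooth \<mu> (1 / real (Suc n)) x)
       = (CLINT t|lborel. iexp (- (t \<bullet> x)) * \<phi> n t)"
      unfolding smooth_fourier[OF mu, of "1 / real (Suc n)" x, simplified, unfolded of_nat_Suc[symmetric]]
        \<phi>_def scaleR_conv_of_real
      by (subst smooth_fourier[OF mu], simp) (simp add: mult.assoc mult.left_commute)
    then have "Re ((2 * pi) ^ DIM('b) * complex_of_real (smooth \<mu> (1 / real (Suc n)) x))
       = Re (CLINT t|lborel. iexp (- (t \<bullet> x)) * \<phi> n t)" by simp
    also have "Re ((2 * pi) ^ DIM('b) * complex_of_real (smooth \<mu> (1 / real (Suc n)) x))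
       = (2 * pi) ^ DIM('b) * smooth \<mu> (1 / real (Suc n)) x"
      by (metis Re_complex_of_real of_real_mult of_real_power)
    finally show ?thesis unfolding inv_fourier_def by (simp add: field_simps)
  qed
  have lim: "(\<lambda>n. smooth \<mu> (1 / real (Suc n)) x) \<longlonglongrightarrow> ?f x" for x
  proof -
    have lim0: "(\<lambda>n. 1 / real (Suc n)) \<longlonglongrightarrow> 0" by (rule LIMSEQ_Suc[OF lim_1_over_n])
    have "(\<lambda>n. CLINT t|lborel. iexp (- (t \<bullet> x)) * \<phi> n t) \<longlonglongrightarrow> (CLINT t|lborel. iexp (- (t \<bullet> x)) * cfun \<mu> t)"
    proof (rule integral_dominated_convergence[where w = "\<lambda>t. cmod (cfun \<mu> t)"])
      show "AE t in lborel. (\<lambda>n. iexp (- (t \<bullet> x)) * \<phi> n t) \<longlonglongrightarrow> iexp (- (t \<bullet> x)) * cfun \<mu> t"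
      proof (intro AE_I2 tendsto_mult tendsto_const)
        fix t
        have "(\<lambda>n. \<phi> n t) \<longlonglongrightarrow> exp (- (0 * norm t)\<^sup>2 / 2) *\<^sub>R cfun \<mu> t"
          unfolding \<phi>_def by (intro tendsto_intros lim0) auto
        then show "(\<lambda>n. \<phi> n t) \<longlonglongrightarrow> cfun \<mu> t" by simp
      qed
    qed (use int in \<open>auto simp: norm_mult phi_le\<close>)
    then show ?thesis unfolding sm inv_fourier_def
      by (intro tendsto_divide tendsto_const tendsto_Re) auto
  qed
  show nn: "0 \<le> ?f x" for x
    by (rule LIMSEQ_le_const[OF lim]) (auto simp: smooth_nonneg)
  show "\<mu> = density lborel (\<lambda>x. ennreal (?f x))"
  proof (rule measure_eq_if_test_integrals_eq[OF mu])
    fix h :: "'b \<Rightarrow> real"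
    assume cont: "continuous_on UNIV h" and h: "\<And>x. 0 \<le> h x \<and> h x \<le> 1" and bd: "bounded {x. h x \<noteq> 0}"
    have ab: "\<bar>h x\<bar> \<le> 1" for x using h[of x] by simp
    have [measurable]: "h \<in> borel_measurable borel"
      using cont by (rule borel_measurable_continuous_onI)
    obtain B where B: "{x. h x \<noteq> 0} \<subseteq> cball 0 B"
      using bounded_subset_ballD[OF bd, of 0] ball_subset_cball by fast
    have C0: "0 \<le> C" by (simp add: C_def)
    have dom: "\<bar>h x * g\<bar> \<le> C * indicator (cball 0 B) x" if "\<bar>g\<bar> \<le> C" for x g
    proof (cases "h x = 0")
      case False
      then have "x \<in> cball 0 B" using B by auto
      moreover have "\<bar>h x * g\<bar> \<le> 1 * C" unfolding abs_mult using ab that by (intro mult_mono) auto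
      ultimately show ?thesis by simp
    qed (use C0 in simp)
    have sm_le: "\<bar>smooth \<mu> (1 / real (Suc n)) x\<bar> \<le> C" for n x
    proof -
      have "\<bar>smooth \<mu> (1 / real (Suc n)) x\<bar> \<le> (LINT t|lborel. cmod (\<phi> n t)) / (2 * pi) ^ DIM('b)"
        unfolding sm by (rule inv_fourier_le[OF phi_int])
      also have "\<dots> \<le> C"
        unfolding C_def by (intro divide_right_mono integral_mono integrable_norm phi_int int phi_le) auto
      finally show ?thesis .
    qed
    have f_le: "\<bar>?f x\<bar> \<le> C" for x unfolding C_def by (rule inv_fourier_le[OF int])
    have ball_int: "integrable lborel (\<lambda>x :: 'b. C * indicator (cball 0 B) x :: real)"
      using emeasure_lborel_cball_finite[of "0 :: 'b" B]
      by (intro integrable_mult_right integrable_real_indicator) auto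
    have "(\<lambda>n. LINT x|lborel. h x * smooth \<mu> (1 / real (Suc n)) x) \<longlonglongrightarrow> (LINT x|lborel. h x * ?f x)"
    proof (rule integral_dominated_convergence[where w = "\<lambda>x. C * indicator (cball 0 B) x"])
      show "(\<lambda>x. h x * smooth \<mu> (1 / real (Suc n)) x) \<in> borel_measurable lborel" for n
        unfolding sm by measurable
      show "AE x in lborel. norm (h x * smooth \<mu> (1 / real (Suc n)) x) \<le> C * indicator (cball 0 B) x" for n
        unfolding real_norm_def by (intro AE_I2 dom sm_le)
      show "AE x in lborel. (\<lambda>n. h x * smooth \<mu> (1 / real (Suc n)) x) \<longlonglongrightarrow> h x * ?f x"
        by (intro AE_I2 tendsto_mult tendsto_const lim)
    qed (use ball_int in auto)
    moreover have "(\<lambda>n. LINT x|lborel. h x * smooth \<mu> (1 / real (Suc n)) x) \<longlonglongrightarrow> (LINT y|\<mu>. h y)"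
      by (rule smooth_tendsto[OF mu cont ab])
    ultimately have eq: "(LINT y|\<mu>. h y) = (LINT x|lborel. h x * ?f x)"
      by (rule LIMSEQ_unique[rotated])
    have "integrable \<mu> h"
      by (rule finite_measure.integrable_const_bound[where B = 1])
        (use mu ab in \<open>auto simp: prob_space_def cong: measurable_cong_sets\<close>)
    then have "(\<integral>\<^sup>+x. ennreal (h x) \<partial>\<mu>) = ennreal (LINT x|lborel. h x * ?f x)"
      using h by (subst nn_integral_eq_integral) (auto simp: eq)
    moreover have "integrable lborel (\<lambda>x. h x * ?f x)"
    proof (rule Bochner_Integration.integrable_bound[OF ball_int])
      show "AE x in lborel. norm (h x * ?f x) \<le> norm (C * indicator (cball 0 B) x)"
        using dom[OF f_le] by (intro AE_I2) (simp add: order_trans[OF _ abs_ge_self])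
    qed measurable
    then have "ennreal (LINT x|lborel. h x * ?f x) = (\<integral>\<^sup>+x. ennreal (h x * ?f x) \<partial>lborel)"
      by (intro nn_integral_eq_integral[symmetric]) (auto simp: h nn)
    ultimately have "(\<integral>\<^sup>+x. ennreal (h x) \<partial>\<mu>) = (\<integral>\<^sup>+x. ennreal (h x * ?f x) \<partial>lborel)" by simp
    also have "\<dots> = (\<integral>\<^sup>+x. ennreal (h x) \<partial>density lborel (\<lambda>x. ennreal (?f x)))"
      by (subst nn_integral_density) (auto simp: ennreal_mult h nn mult.commute)
    finally show "(\<integral>\<^sup>+x. ennreal (h x) \<partial>\<mu>) = (\<integral>\<^sup>+x. ennreal (h x) \<partial>density lborel (\<lambda>x. ennreal (?f x)))" .
  qed simp
qed

section \<open>Decay of integrable characteristic functions\<close>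

lemma integrable_iexp_inner:
  fixes \<mu> :: "'b::euclidean_space measure"
  assumes "prob_space \<mu>" and [measurable_cong]: "sets \<mu> = sets borel"
  shows "integrable \<mu> (\<lambda>x. iexp (t \<bullet> x))"
proof -
  interpret prob_space \<mu> by fact
  show ?thesis by (rule integrable_const_bound[where B = 1]) auto
qed

lemma cfun_le_1:
  fixes \<mu> :: "'b::euclidean_space measure"
  assumes "prob_space \<mu>" "sets \<mu> = sets borel"
  shows "cmod (cfun \<mu> t) \<le> 1"
proof -
  interpret prob_space \<mu> by fact
  have "cmod (cfun \<mu> t) \<le> (LINT x|\<mu>. 1)"
    unfolding cfun_def
    by (rule Bochner_Integration.integral_norm_bound_integral[OF integrable_iexp_inner[OF assms]]) auto
  then show ?thesis by (simp add: prob_space)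
qed

lemma cfun_lipschitz:
  fixes \<mu> :: "'b::euclidean_space measure"
  assumes mu: "prob_space \<mu>" "sets \<mu> = sets borel" and int: "integrable \<mu> (\<lambda>x. x)"
  shows "cmod (cfun \<mu> t - cfun \<mu> s) \<le> norm (t - s) * (LINT x|\<mu>. norm x)"
proof -
  have "cfun \<mu> t - cfun \<mu> s = (CLINT x|\<mu>. iexp (t \<bullet> x) - iexp (s \<bullet> x))"
    unfolding cfun_def
    by (rule Bochner_Integration.integral_diff[symmetric]; rule integrable_iexp_inner[OF mu])
  moreover have "cmod (CLINT x|\<mu>. iexp (t \<bullet> x) - iexp (s \<bullet> x)) \<le> (LINT x|\<mu>. norm (t - s) * norm x)"
  proof (rule Bochner_Integration.integral_norm_bound_integral)
    show "integrable \<mu> (\<lambda>x. iexp (t \<bullet> x) - iexp (s \<bullet> x))"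
      by (intro Bochner_Integration.integrable_diff integrable_iexp_inner[OF mu])
    show "integrable \<mu> (\<lambda>x. norm (t - s) * norm x)" using int by simp
    fix x
    have "iexp (t \<bullet> x) - iexp (s \<bullet> x) = iexp (s \<bullet> x) * (iexp ((t - s) \<bullet> x) - 1)"
      by (simp add: inner_diff_left exp_diff field_simps)
    then have "cmod (iexp (t \<bullet> x) - iexp (s \<bullet> x)) = cmod (iexp ((t - s) \<bullet> x) - 1)"
      by (simp add: norm_mult)
    also have "\<dots> \<le> \<bar>(t - s) \<bullet> x\<bar>"
      using iexp_approx1[of "(t - s) \<bullet> x" 0] by simp
    also have "\<dots> \<le> norm (t - s) * norm x" by (rule Cauchy_Schwarz_ineq2)
    finally show "cmod (iexp (t \<bullet> x) - iexp (s \<bullet> x)) \<le> norm (t - s) * norm x" .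
  qed
  ultimately show ?thesis by simp
qed

text \<open>Rotate by the argument \<open>a\<close> of \<open>cfun \<mu> t\<close>, so that \<open>\<bar>cfun \<mu> t\<bar>\<close> is the mean of \<open>cos u\<close> with \<open>u = t \<bullet> x - a\<close>
  and \<open>\<bar>cfun \<mu> (2 t)\<bar>\<close> is at least the mean of \<open>cos (2 u)\<close>. The claim is then the mean of
  \<open>1 - cos (2 u) \<le> 4 (1 - cos u)\<close>.\<close>

lemma cfun_doubling:
  fixes \<mu> :: "'b::euclidean_space measure"
  assumes mu: "prob_space \<mu>" and [measurable_cong]: "sets \<mu> = sets borel"
  shows "1 - cmod (cfun \<mu> (2 *\<^sub>R t)) \<le> 4 * (1 - cmod (cfun \<mu> t))"
proof -
  interpret prob_space \<mu> by fact
  have rot: "Re (iexp (- a) * cfun \<mu> u) = (LINT x|\<mu>. cos (u \<bullet> x - a))" for a u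
  proof -
    have "iexp (- a) * cfun \<mu> u = (CLINT x|\<mu>. iexp (- a) * iexp (u \<bullet> x))"
      unfolding cfun_def by (rule integral_mult_right_zero[symmetric])
    also have "\<dots> = (CLINT x|\<mu>. iexp (u \<bullet> x - a))"
      by (simp add: exp_diff exp_minus field_simps)
    finally have "Re (iexp (- a) * cfun \<mu> u) = Re (CLINT x|\<mu>. iexp (u \<bullet> x - a))" by simp
    also have "\<dots> = (LINT x|\<mu>. Re (iexp (u \<bullet> x - a)))"
      by (rule integral_Re[symmetric]) (rule integrable_const_bound[where B = 1]; auto)
    finally show ?thesis by (simp add: Re_exp)
  qed
  have int: "integrable \<mu> (\<lambda>x. cos (u \<bullet> x - a))" for u a
    by (rule integrable_const_bound[where B = 1]) auto
  define a where "a = Arg (cfun \<mu> t)"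
  have "cfun \<mu> t = cmod (cfun \<mu> t) * iexp a"
    unfolding a_def by (metis Arg_eq cis_conv_exp mult_zero_left norm_zero of_real_0 rcis_cmod_Arg rcis_def)
  then have "iexp (- a) * cfun \<mu> t = cmod (cfun \<mu> t)"
    by (simp add: exp_minus field_simps)
  then have c: "cmod (cfun \<mu> t) = (LINT x|\<mu>. cos (t \<bullet> x - a))"
    using rot[of a t] by simp
  have "(LINT x|\<mu>. cos ((2 *\<^sub>R t) \<bullet> x - 2 * a)) \<le> cmod (iexp (- (2 * a)) * cfun \<mu> (2 *\<^sub>R t))"
    unfolding rot[symmetric] by (rule complex_Re_le_cmod)
  also have "\<dots> = cmod (cfun \<mu> (2 *\<^sub>R t))" by (simp add: norm_mult)
  finally have "1 - cmod (cfun \<mu> (2 *\<^sub>R t)) \<le> 1 - (LINT x|\<mu>. cos ((2 *\<^sub>R t) \<bullet> x - 2 * a))"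
    by simp
  also have "\<dots> = (LINT x|\<mu>. 1 - cos ((2 *\<^sub>R t) \<bullet> x - 2 * a))"
    using int[of "2 *\<^sub>R t" "2 * a"]
    by (subst Bochner_Integration.integral_diff) (auto simp: prob_space)
  also have "\<dots> \<le> (LINT x|\<mu>. 4 * (1 - cos (t \<bullet> x - a)))"
  proof (rule integral_mono)
    fix x
    have "cos ((2 *\<^sub>R t) \<bullet> x - 2 * a) = 2 * (cos (t \<bullet> x - a))\<^sup>2 - 1"
      using cos_double_cos[of "t \<bullet> x - a"] by (simp add: algebra_simps)
    moreover have "0 \<le> (1 - cos (t \<bullet> x - a))\<^sup>2" by simp
    ultimately show "1 - cos ((2 *\<^sub>R t) \<bullet> x - 2 * a) \<le> 4 * (1 - cos (t \<bullet> x - a))"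
      by (simp add: power2_eq_square algebra_simps)
  qed (use int[of "2 *\<^sub>R t" "2 * a"] int[of t a] in auto)
  also have "\<dots> = 4 * (1 - (LINT x|\<mu>. cos (t \<bullet> x - a)))"
    by (subst integral_mult_right_zero, subst Bochner_Integration.integral_diff) (auto simp: prob_space int)
  finally show ?thesis by (simp add: c)
qed

text \<open>Where the characteristic function exceeds 1/2, the Lipschitz property keeps it above 1/4 on a ball of
  fixed radius. Far out, the integral of the power is too small to contain such a ball.\<close>

lemma cfun_small_at_infinity:
  fixes \<mu> :: "'b::euclidean_space measure"
  assumes mu: "prob_space \<mu>" and [measurable_cong]: "sets \<mu> = sets borel" and int: "integrable \<mu> (\<lambda>x. x)"
    and nu: "\<nu> \<ge> 0" and fin: "(\<integral>\<^sup>+t. ennreal (cmod (cfun \<mu> t) powr \<nu>) \<partial>lborel) < \<infinity>"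
  obtains R where "R > 0" "\<And>t. norm t \<ge> R \<Longrightarrow> cmod (cfun \<mu> t) \<le> 1 / 2"
proof -
  have [measurable]: "cfun \<mu> \<in> borel_measurable borel" by (rule cfun_measurable[OF assms(1,2)])
  define g where "g t = cmod (cfun \<mu> t) powr \<nu>" for t
  have [measurable]: "g \<in> borel_measurable borel" unfolding g_def by measurable
  have g0: "0 \<le> g t" for t by (simp add: g_def)
  have g_int: "integrable lborel g"
    by (rule integrableI_nonneg) (use fin in \<open>auto simp: g_def\<close>)
  define L where "L = (LINT x|\<mu>. norm x) + 1"
  have L: "L \<ge> 1" "L > 0" unfolding L_def by (simp_all add: add_nonneg_pos)
  define \<delta> where "\<delta> = 1 / (4 * L)"
  have delta: "\<delta> > 0" "\<delta> \<le> 1" using L by (auto simp: \<delta>_def field_simps)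
  define v where "v = measure lborel (ball (0 :: 'b) \<delta>)"
  have v: "v > 0" unfolding v_def using delta
    by (metis content_ball_pos measure_completion open_ball borel_open sets_lborel)
  have vt: "measure lborel (ball t \<delta>) = v" for t :: 'b
    unfolding v_def using delta
    by (metis content_ball less_imp_le measure_completion open_ball borel_open sets_lborel)
  have "(\<lambda>n. LINT t|lborel. g t * indicator {t. norm t > real n} t) \<longlonglongrightarrow> (LINT t|(lborel :: 'b measure). (0 :: real))"
  proof (rule integral_dominated_convergence[where w = g])
    show "AE t in lborel. (\<lambda>n. g t * indicator {t. norm t > real n} t) \<longlonglongrightarrow> 0"
    proof (rule AE_I2)
      fix t :: 'b
      obtain N :: nat where "norm t \<le> real N" using real_arch_simple by blast
      then have "\<forall>\<^sub>F n in sequentially. g t * indicator {t. norm t > real n} t = 0"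
        by (intro eventually_sequentiallyI[of N]) auto
      then show "(\<lambda>n. g t * indicator {t. norm t > real n} t) \<longlonglongrightarrow> 0"
        by (rule tendsto_eventually)
    qed
  qed (use g_int g0 in \<open>auto simp: indicator_def\<close>)
  then have "(\<lambda>n. LINT t|lborel. g t * indicator {t. norm t > real n} t) \<longlonglongrightarrow> 0" by simp
  moreover have "0 < (1 / 4) powr \<nu> * v" using v by simp
  ultimately have "\<forall>\<^sub>F n in sequentially. (LINT t|lborel. g t * indicator {t. norm t > real n} t) < (1 / 4) powr \<nu> * v"
    by (rule order_tendstoD)
  then obtain n where n: "(LINT t|lborel. g t * indicator {t. norm t > real n} t) < (1 / 4) powr \<nu> * v"
    by (auto simp: eventually_sequentially)
  show thesis
  proof (rule that[of "real n + 1"])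
    fix t :: 'b assume t: "norm t \<ge> real n + 1"
    show "cmod (cfun \<mu> t) \<le> 1 / 2"
    proof (rule ccontr)
      assume "\<not> cmod (cfun \<mu> t) \<le> 1 / 2"
      then have big: "cmod (cfun \<mu> t) > 1 / 2" by simp
      have ball: "norm s > real n \<and> (1 / 4) powr \<nu> \<le> g s" if s: "s \<in> ball t \<delta>" for s
      proof
        have d: "norm (t - s) < \<delta>" using s by (simp add: dist_norm)
        then show "norm s > real n" using t delta norm_triangle_ineq2[of t s] by linarith
        have "cmod (cfun \<mu> t - cfun \<mu> s) \<le> norm (t - s) * (LINT x|\<mu>. norm x)"
          by (rule cfun_lipschitz[OF assms(1,2) int])
        also have "\<dots> \<le> \<delta> * L" using d delta unfolding L_def by (intro mult_mono) auto
        also have "\<dots> = 1 / 4" using L by (simp add: \<delta>_def)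
        finally have "1 / 4 \<le> cmod (cfun \<mu> s)"
          using big norm_triangle_ineq2[of "cfun \<mu> t" "cfun \<mu> s"] by linarith
        then show "(1 / 4) powr \<nu> \<le> g s" unfolding g_def using nu by (intro powr_mono2) auto
      qed
      have "(1 / 4) powr \<nu> * v = (LINT s|lborel. (1 / 4) powr \<nu> * indicator (ball t \<delta>) s)"
        by (simp add: vt)
      also have "\<dots> \<le> (LINT s|lborel. g s * indicator {s. norm s > real n} s)"
      proof (rule integral_mono)
        show "integrable lborel (\<lambda>s. (1 / 4) powr \<nu> * indicator (ball t \<delta>) s :: real)"
          using emeasure_lborel_ball_finite[of t \<delta>]
          by (intro integrable_mult_right integrable_real_indicator) auto
        show "integrable lborel (\<lambda>s. g s * indicator {s. norm s > real n} s)"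
          by (rule Bochner_Integration.integrable_bound[OF g_int]) (auto simp: indicator_def g0)
        show "(1 / 4) powr \<nu> * indicator (ball t \<delta>) s \<le> g s * indicator {s. norm s > real n} s" for s
          using ball[of s] g0[of s] by (auto simp: indicator_def)
      qed
      finally show False using n by simp
    qed
  qed simp
qed

text \<open>Double \<open>t\<close> until its norm first reaches \<open>R\<close>. There the characteristic function is at most 1/2, and
  \<open>k\<close> applications of the doubling inequality give \<open>1 - \<bar>cfun \<mu> t\<bar> \<ge> 1 / (2 * 4 ^ k)\<close>, where
  \<open>2 ^ k\<close> is comparable to \<open>R / \<bar>t\<bar>\<close>.\<close>

lemma cfun_gaussian_bound:
  fixes \<mu> :: "'b::euclidean_space measure"
  assumes mu: "prob_space \<mu>" "sets \<mu> = sets borel"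
    and R: "R > 0" "\<And>t. norm t \<ge> R \<Longrightarrow> cmod (cfun \<mu> t) \<le> 1 / 2" and t: "norm t \<le> R"
  shows "cmod (cfun \<mu> t) \<le> exp (- (norm t)\<^sup>2 / (8 * R\<^sup>2))"
proof (cases "t = 0")
  case True
  then show ?thesis using cfun_le_1[OF mu, of 0] by simp
next
  case False
  have "\<exists>k. R \<le> 2 ^ k * norm t"
    using real_arch_pow[of 2 "R / norm t"] False by (auto simp: field_simps intro: less_imp_le)
  define k where "k = (LEAST k. R \<le> 2 ^ k * norm t)"
  have k1: "R \<le> 2 ^ k * norm t"
    unfolding k_def by (rule LeastI_ex) fact
  have k2: "2 ^ k * norm t \<le> 2 * R"
  proof (cases k)
    case (Suc j)
    have "j < (LEAST k. R \<le> 2 ^ k * norm t)" using Suc by (simp add: k_def)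
    then have "\<not> R \<le> 2 ^ j * norm t" by (rule not_less_Least)
    then show ?thesis using Suc by simp
  qed (use t R in simp)
  have iter: "1 - cmod (cfun \<mu> (2 ^ m *\<^sub>R t)) \<le> 4 ^ m * (1 - cmod (cfun \<mu> t))" for m
  proof (induction m)
    case (Suc m)
    have "1 - cmod (cfun \<mu> (2 ^ Suc m *\<^sub>R t)) \<le> 4 * (1 - cmod (cfun \<mu> (2 ^ m *\<^sub>R t)))"
      using cfun_doubling[OF mu, of "2 ^ m *\<^sub>R t"] by simp
    also have "\<dots> \<le> 4 * (4 ^ m * (1 - cmod (cfun \<mu> t)))" using Suc by simp
    finally show ?case by simp
  qed simp
  have "cmod (cfun \<mu> (2 ^ k *\<^sub>R t)) \<le> 1 / 2" by (rule R(2)) (use k1 in simp)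
  then have half: "1 / 2 \<le> 4 ^ k * (1 - cmod (cfun \<mu> t))" using iter[of k] by linarith
  have "(2 ^ k * norm t)\<^sup>2 \<le> (2 * R)\<^sup>2" using k2 by (intro power_mono) auto
  also have "(2 ^ k * norm t)\<^sup>2 = 4 ^ k * (norm t)\<^sup>2"
    by (simp add: power_mult_distrib power_mult[symmetric] mult.commute[of k 2] power_mult)
  finally have "4 ^ k * (norm t)\<^sup>2 / (8 * R\<^sup>2) \<le> 1 / 2"
    using R by (simp add: field_simps power_mult_distrib)
  also note half
  finally have "4 ^ k * ((norm t)\<^sup>2 / (8 * R\<^sup>2)) \<le> 4 ^ k * (1 - cmod (cfun \<mu> t))" by simp
  then have "(norm t)\<^sup>2 / (8 * R\<^sup>2) \<le> 1 - cmod (cfun \<mu> t)" by (rule mult_left_le_imp_le) simp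
  then show ?thesis using exp_ge_add_one_self[of "- (norm t)\<^sup>2 / (8 * R\<^sup>2)"] by simp
qed

section \<open>Concentration of sums of independent vectors\<close>

lemma nn_integral_lborel_scaleR:
  fixes f :: "'b::euclidean_space \<Rightarrow> ennreal"
  assumes [measurable]: "f \<in> borel_measurable borel" and c: "c \<noteq> 0"
  shows "(\<integral>\<^sup>+x. f x \<partial>lborel) = ennreal (\<bar>c\<bar> ^ DIM('b)) * (\<integral>\<^sup>+x. f (c *\<^sub>R x) \<partial>lborel)"
  using c by (subst lborel_affine[of c 0])
    (simp_all add: nn_integral_density nn_integral_distr nn_integral_cmult ennreal_power)

lemma (in prob_space) cfun_distr:
  assumes [measurable]: "W \<in> borel_measurable M"
  shows "cfun (distr M borel W) t = char_fun M W t"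
  unfolding cfun_def char_fun_def by (subst integral_distr) auto

lemma (in prob_space) cfun_scaled_sum:
  fixes X :: "'i \<Rightarrow> 'a \<Rightarrow> 'b::euclidean_space"
  assumes indep: "indep_vars (\<lambda>_. borel) X I" and law: "\<And>i. i \<in> I \<Longrightarrow> distr M borel (X i) = \<mu>"
  shows "cfun (distr M borel (\<lambda>\<omega>. c *\<^sub>R (\<Sum>i\<in>I. X i \<omega>))) t = cfun \<mu> (c *\<^sub>R t) ^ card I"
proof -
  have [measurable]: "X i \<in> borel_measurable M" if "i \<in> I" for i
    using indep that unfolding indep_vars_def2 by auto
  have "indep_vars (\<lambda>_. borel) (\<lambda>i \<omega>. c * (t \<bullet> X i \<omega>)) I"
    by (rule indep_vars_compose2[OF indep, where Y = "\<lambda>_ x. c * (t \<bullet> x)"]) auto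
  then have "char (distr M borel (\<lambda>\<omega>. \<Sum>i\<in>I. c * (t \<bullet> X i \<omega>))) 1
      = (\<Prod>i\<in>I. char (distr M borel (\<lambda>\<omega>. c * (t \<bullet> X i \<omega>))) 1)"
    by (rule char_distr_sum)
  also have "\<dots> = (\<Prod>i\<in>I. cfun \<mu> (c *\<^sub>R t))"
  proof (rule prod.cong[OF refl])
    fix i assume i: "i \<in> I"
    have "cfun (distr M borel (X i)) (c *\<^sub>R t) = char (distr M borel (\<lambda>\<omega>. c * (t \<bullet> X i \<omega>))) 1"
      unfolding cfun_def char_def using i by (subst (1 2) integral_distr) auto
    then show "char (distr M borel (\<lambda>\<omega>. c * (t \<bullet> X i \<omega>))) 1 = cfun \<mu> (c *\<^sub>R t)"
      using law[OF i] by simp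
  qed
  finally have "char (distr M borel (\<lambda>\<omega>. \<Sum>i\<in>I. c * (t \<bullet> X i \<omega>))) 1 = cfun \<mu> (c *\<^sub>R t) ^ card I"
    by simp
  moreover have "cfun (distr M borel (\<lambda>\<omega>. c *\<^sub>R (\<Sum>i\<in>I. X i \<omega>))) t
      = char (distr M borel (\<lambda>\<omega>. \<Sum>i\<in>I. c * (t \<bullet> X i \<omega>))) 1"
    unfolding cfun_def char_def
    by (subst (1 2) integral_distr) (auto simp: inner_sum_right sum_distrib_left)
  ultimately show ?thesis by simp
qed

lemma (in prob_space) indep_var_sum_rest:
  fixes X :: "'i \<Rightarrow> 'a \<Rightarrow> 'b::euclidean_space"
  assumes I: "finite I" "i \<notin> I" and indep: "indep_vars (\<lambda>_. borel) X (insert i I)"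
  shows "indep_var borel (X i) borel (\<lambda>\<omega>. \<Sum>i\<in>I. X i \<omega>)"
  using indep_var_compose[OF indep_var_restrict[OF indep, of "{i}" I],
      of "\<lambda>f. f i" borel "\<lambda>f. \<Sum>i\<in>I. f i" borel] I
  by (simp add: comp_def subset_insertI)

text \<open>Given \<open>V\<close>, the part of the law of \<open>U + V\<close> that comes from points where the density of \<open>U\<close> is at most
  \<open>T\<close> is a translate of a measure with density at most \<open>T\<close>.\<close>

lemma (in prob_space) truncated_density_sum:
  fixes U V :: "'a \<Rightarrow> 'b::euclidean_space" and f :: "'b \<Rightarrow> real"
  assumes indep: "indep_var borel U borel V"
    and [measurable]: "f \<in> borel_measurable borel" and A [measurable]: "A \<in> sets borel"
    and law: "distr M borel U = density lborel (\<lambda>x. ennreal (f x))"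
  shows "emeasure M {\<omega> \<in> space M. U \<omega> + V \<omega> \<in> A \<and> f (U \<omega>) \<le> T} \<le> ennreal T * emeasure lborel A"
proof -
  have [measurable]: "U \<in> borel_measurable M" "V \<in> borel_measurable M"
    using indep_var_rv1[OF indep] indep_var_rv2[OF indep] .
  interpret U: prob_space "distr M borel U" by (rule prob_space_distr) simp
  interpret V: prob_space "distr M borel V" by (rule prob_space_distr) simp
  interpret P: pair_sigma_finite "distr M borel U" "distr M borel V" ..
  let ?B = "{(u, v). u + v \<in> A \<and> f u \<le> T}"
  have "{z \<in> space (borel \<Otimes>\<^sub>M borel). fst z + snd z \<in> A \<and> f (fst z) \<le> T} \<in> sets (borel \<Otimes>\<^sub>M borel)"
    by measurable
  also have "{z \<in> space (borel \<Otimes>\<^sub>M borel). fst z + snd z \<in> A \<and> f (fst z) \<le> T} = ?B"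
    by (auto simp: space_pair_measure)
  finally have B [measurable]: "?B \<in> sets (borel \<Otimes>\<^sub>M borel)" .
  have slice: "(\<integral>\<^sup>+u. indicator ?B (u, v) \<partial>distr M borel U) \<le> ennreal T * emeasure lborel A" for v
  proof -
    have "(\<integral>\<^sup>+u. indicator ?B (u, v) \<partial>distr M borel U) = (\<integral>\<^sup>+u. ennreal (f u) * indicator ?B (u, v) \<partial>lborel)"
      unfolding law by (rule nn_integral_density) auto
    also have "\<dots> \<le> (\<integral>\<^sup>+u. ennreal T * indicator A (v + u) \<partial>lborel)"
      by (intro nn_integral_mono) (auto simp: indicator_def ennreal_leI add.commute)
    also have "\<dots> = (\<integral>\<^sup>+u. ennreal T * indicator A u \<partial>distr lborel borel ((+) v))"
      by (subst nn_integral_distr) auto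
    also have "\<dots> = ennreal T * emeasure lborel A"
      by (simp add: lborel_distr_plus nn_integral_cmult_indicator)
    finally show ?thesis .
  qed
  have "emeasure M {\<omega> \<in> space M. U \<omega> + V \<omega> \<in> A \<and> f (U \<omega>) \<le> T}
     = emeasure (distr M (borel \<Otimes>\<^sub>M borel) (\<lambda>\<omega>. (U \<omega>, V \<omega>))) ?B"
    by (subst emeasure_distr) (auto intro!: arg_cong[where f = "emeasure M"])
  also have "distr M (borel \<Otimes>\<^sub>M borel) (\<lambda>\<omega>. (U \<omega>, V \<omega>)) = distr M borel U \<Otimes>\<^sub>M distr M borel V"
    using indep unfolding indep_var_distribution_eq by simp
  also have "emeasure (distr M borel U \<Otimes>\<^sub>M distr M borel V) ?B
     = (\<integral>\<^sup>+z. indicator ?B z \<partial>(distr M borel U \<Otimes>\<^sub>M distr M borel V))"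
    by (rule nn_integral_indicator[symmetric]) (simp add: sets_pair_measure_cong[OF sets_distr sets_distr])
  also have "\<dots> = (\<integral>\<^sup>+v. \<integral>\<^sup>+u. indicator ?B (u, v) \<partial>distr M borel U \<partial>distr M borel V)"
    by (rule P.nn_integral_snd[symmetric]) (simp cong: measurable_cong_sets add: measurable_distr_eq1)
  also have "\<dots> \<le> (\<integral>\<^sup>+v. ennreal T * emeasure lborel A \<partial>distr M borel V)"
    by (intro nn_integral_mono slice)
  also have "\<dots> = ennreal T * emeasure lborel A"
    using V.emeasure_space_1 by simp
  finally show ?thesis .
qed

text \<open>Either some summand lies where the density is at most \<open>T\<close>, which \<open>truncated_density_sum\<close> covers with
  the remaining summands in the role of \<open>V\<close>, or all summands lie where it exceeds \<open>T\<close>, and by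
  independence the probabilities of these events multiply. The power \<open>k\<close> gained here replaces
  Young's convolution inequality.\<close>

lemma (in prob_space) iid_sum_concentration:
  fixes Y :: "nat \<Rightarrow> 'a \<Rightarrow> 'b::euclidean_space" and f :: "'b \<Rightarrow> real"
  assumes indep: "indep_vars (\<lambda>_. borel) Y {..<k}" and k: "k > 0"
    and [measurable]: "f \<in> borel_measurable borel" and [measurable]: "A \<in> sets borel"
    and law: "\<And>j. j < k \<Longrightarrow> distr M borel (Y j) = density lborel (\<lambda>x. ennreal (f x))"
  shows "emeasure (distr M borel (\<lambda>\<omega>. \<Sum>j<k. Y j \<omega>)) A
    \<le> of_nat k * (ennreal T * emeasure lborel A)
      + emeasure (density lborel (\<lambda>x. ennreal (f x))) {x. f x > T} ^ k"
proof -
  have [measurable]: "Y j \<in> borel_measurable M" if "j < k" for j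
    using indep that unfolding indep_vars_def2 by auto
  let ?S = "\<lambda>\<omega>. \<Sum>j<k. Y j \<omega>"
  let ?G = "\<lambda>j. {\<omega> \<in> space M. ?S \<omega> \<in> A \<and> f (Y j \<omega>) \<le> T}"
  let ?E = "\<Inter>j<k. Y j -` {x. f x > T} \<inter> space M"
  have meas [measurable]: "{x. f x > T} \<in> sets borel" by measurable
  have G_meas: "?G j \<in> sets M" if "j < k" for j using that by measurable
  have E_meas: "?E \<in> sets M" using k by (intro sets.finite_INT) auto
  have G: "emeasure M (?G j) \<le> ennreal T * emeasure lborel A" if j: "j < k" for j
  proof -
    have "indep_var borel (Y j) borel (\<lambda>\<omega>. \<Sum>i\<in>{..<k} - {j}. Y i \<omega>)"
      using j by (intro indep_var_sum_rest) (auto simp: insert_absorb indep)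
    note truncated_density_sum[OF this, of f A T]
    moreover have "Y j \<omega> + (\<Sum>i\<in>{..<k} - {j}. Y i \<omega>) = ?S \<omega>" for \<omega>
      using j by (subst sum.remove[of "{..<k}" j]) auto
    ultimately show ?thesis using law[OF j] by simp
  qed
  have "emeasure M ?E = ennreal (\<Prod>j<k. prob (Y j -` {x. f x > T} \<inter> space M))"
    unfolding emeasure_eq_measure using k by (subst indep_varsD_finite[OF indep]) auto
  also have "\<dots> = (\<Prod>j<k. emeasure M (Y j -` {x. f x > T} \<inter> space M))"
    by (simp add: emeasure_eq_measure prod_ennreal)
  also have "\<dots> = (\<Prod>j<k. emeasure (density lborel (\<lambda>x. ennreal (f x))) {x. f x > T})"
  proof (rule prod.cong[OF refl])
    fix j assume "j \<in> {..<k}"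
    then have j: "j < k" by simp
    show "emeasure M (Y j -` {x. f x > T} \<inter> space M) = emeasure (density lborel (\<lambda>x. ennreal (f x))) {x. f x > T}"
      unfolding law[OF j, symmetric] using j by (intro emeasure_distr[symmetric]) auto
  qed
  finally have E: "emeasure M ?E = emeasure (density lborel (\<lambda>x. ennreal (f x))) {x. f x > T} ^ k"
    by simp
  have "emeasure (distr M borel ?S) A = emeasure M (?S -` A \<inter> space M)"
    by (rule emeasure_distr) auto
  also have "\<dots> \<le> emeasure M ((\<Union>j<k. ?G j) \<union> ?E)"
    using G_meas E_meas k by (intro emeasure_mono) (auto simp: not_le)
  also have "\<dots> \<le> emeasure M (\<Union>j<k. ?G j) + emeasure M ?E"
    using G_meas E_meas by (intro emeasure_subadditive) auto
  also have "emeasure M (\<Union>j<k. ?G j) \<le> (\<Sum>j<k. emeasure M (?G j))"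
    using G_meas by (intro emeasure_subadditive_finite) auto
  also have "\<dots> \<le> (\<Sum>j<k. ennreal T * emeasure lborel A)"
    by (intro sum_mono G) auto
  finally show ?thesis unfolding E by (simp add: add_right_mono)
qed

text \<open>Markov's inequality for \<open>f powr (r - 1)\<close> under the law with density \<open>f\<close>.\<close>

lemma tail_le_power_integral:
  fixes f :: "'b::euclidean_space \<Rightarrow> real"
  assumes r: "r > 1" and [measurable]: "f \<in> borel_measurable borel" and T: "T > 0"
  shows "emeasure (density lborel (\<lambda>x. ennreal (f x))) {x. f x > T}
    \<le> ennreal (T powr (1 - r)) * (\<integral>\<^sup>+x. ennreal (f x powr r) \<partial>lborel)"
proof -
  have "emeasure (density lborel (\<lambda>x. ennreal (f x))) {x. f x > T}
      = (\<integral>\<^sup>+x. ennreal (f x) * indicator {x. f x > T} x \<partial>lborel)"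
    by (rule emeasure_density) auto
  also have "\<dots> \<le> (\<integral>\<^sup>+x. ennreal (T powr (1 - r)) * ennreal (f x powr r) \<partial>lborel)"
  proof (rule nn_integral_mono)
    fix x
    show "ennreal (f x) * indicator {x. f x > T} x \<le> ennreal (T powr (1 - r)) * ennreal (f x powr r)"
    proof (cases "f x > T")
      case True
      then have "f x = f x powr (1 - r) * f x powr r" using T by (simp add: powr_add[symmetric])
      also have "\<dots> \<le> T powr (1 - r) * f x powr r"
        using True T r by (intro mult_right_mono powr_mono2') auto
      finally show ?thesis using True by (simp add: ennreal_mult[symmetric])
    qed simp
  qed
  finally show ?thesis by (simp add: nn_integral_cmult)
qed

section \<open>Square integrability of densities and characteristic functions\<close>

text \<open>For \<open>T \<rightarrow> \<infinity>\<close> the hypothesis makes null sets of Lebesgue measure null sets of \<open>\<nu>\<close>, so there is a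
  density \<open>F\<close>. On the set where \<open>F > 2 K T\<close> the term \<open>K T \<bar>A\<bar>\<close> is at most half of the probability, so
  this set has probability at most \<open>2 B T powr (- m)\<close>. Finally \<open>\<integral>F\<^sup>2\<close> is the mean of \<open>F\<close> under \<open>\<nu>\<close>,
  and these tails are summable over dyadic levels because \<open>m > 1\<close>.\<close>

lemma square_integrable_density_of_concentration:
  fixes \<nu> :: "'b::euclidean_space measure"
  assumes nu: "prob_space \<nu>" and sets [measurable_cong]: "sets \<nu> = sets borel"
    and K: "K > 0" and B: "B \<ge> 0" and m: "m > 1"
    and conc: "\<And>T A. T > 0 \<Longrightarrow> A \<in> sets borel \<Longrightarrow>
      emeasure \<nu> A \<le> ennreal (K * T) * emeasure lborel A + ennreal (B * T powr (- m))"
  obtains F where "F \<in> borel_measurable borel" "\<And>x. 0 \<le> F x"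
    "\<nu> = density lborel (\<lambda>x. ennreal (F x))" "(\<integral>\<^sup>+x. ennreal ((F x)\<^sup>2) \<partial>lborel) < \<infinity>"
proof -
  interpret prob_space \<nu> by fact
  have ac: "absolutely_continuous lborel \<nu>"
    unfolding absolutely_continuous_def
  proof
    fix A assume "A \<in> null_sets (lborel :: 'b measure)"
    then have A: "A \<in> sets borel" "emeasure lborel A = 0" by auto
    have "((\<lambda>T. B * T powr (- m)) \<longlongrightarrow> B * 0) at_top"
      using m by (intro tendsto_intros tendsto_neg_powr filterlim_ident) auto
    then have lim: "((\<lambda>T. ennreal (B * T powr (- m))) \<longlongrightarrow> 0) at_top"
      by (metis ennreal_0 mult_zero_right tendsto_ennrealI)
    have "emeasure \<nu> A \<le> 0"
    proof (rule tendsto_lowerbound[OF lim])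
      show "\<forall>\<^sub>F T in at_top. emeasure \<nu> A \<le> ennreal (B * T powr (- m))"
        using eventually_gt_at_top[of 0] by eventually_elim (use conc[OF _ A(1)] A(2) in simp)
    qed simp
    then show "A \<in> null_sets \<nu>" using A sets by (auto simp: null_sets_def)
  qed
  define F where "F x = enn2real (RN_deriv lborel \<nu> x)" for x
  have [measurable]: "F \<in> borel_measurable borel" unfolding F_def by measurable
  have F0: "0 \<le> F x" for x by (simp add: F_def)
  have fin: "AE x in lborel. RN_deriv lborel \<nu> x \<noteq> \<infinity>"
    using ac sets by (intro sigma_finite_measure.RN_deriv_finite lborel.sigma_finite_measure_axioms)
      (auto intro: sigma_finite_measure_axioms)
  have "\<nu> = density lborel (RN_deriv lborel \<nu>)"
    using sigma_finite_measure.density_RN_deriv[OF lborel.sigma_finite_measure_axioms ac] sets by simp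
  also have "\<dots> = density lborel (\<lambda>x. ennreal (F x))"
    by (rule density_cong) (use fin in \<open>auto simp: F_def less_top\<close>)
  finally have dens: "\<nu> = density lborel (\<lambda>x. ennreal (F x))" .

  have tail: "emeasure \<nu> {x. F x > 2 * K * T} \<le> ennreal (2 * B * T powr (- m))" if T: "T > 0" for T
  proof -
    let ?A = "{x. F x > 2 * K * T}"
    have A [measurable]: "?A \<in> sets borel" by measurable
    have "ennreal (2 * K * T) * emeasure lborel ?A = (\<integral>\<^sup>+x. ennreal (2 * K * T) * indicator ?A x \<partial>lborel)"
      by (simp add: nn_integral_cmult_indicator)
    also have "\<dots> \<le> (\<integral>\<^sup>+x. ennreal (F x) * indicator ?A x \<partial>lborel)"
      by (intro nn_integral_mono) (auto simp: indicator_def intro: ennreal_leI)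
    also have "\<dots> = emeasure \<nu> ?A"
      by (subst dens) (simp add: emeasure_density)
    finally have le: "ennreal (2 * K * T) * emeasure lborel ?A \<le> emeasure \<nu> ?A" .
    have "emeasure lborel ?A \<noteq> \<infinity>"
    proof
      assume "emeasure lborel ?A = \<infinity>"
      then have "ennreal (2 * K * T) * emeasure lborel ?A = \<infinity>" using K T by (simp add: ennreal_mult_top)
      then show False using le by (simp add: top_unique)
    qed
    then have fA: "emeasure lborel ?A = ennreal (measure lborel ?A)"
      by (intro emeasure_eq_ennreal_measure) simp
    have 1: "2 * K * T * measure lborel ?A \<le> prob ?A"
      using le K T unfolding fA emeasure_eq_measure by (simp add: ennreal_mult[symmetric])
    have "ennreal (prob ?A) \<le> ennreal (K * T * measure lborel ?A + B * T powr (- m))"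
      using conc[OF T A] K T B unfolding fA emeasure_eq_measure
      by (simp add: ennreal_mult[symmetric] ennreal_plus[symmetric] del: ennreal_plus)
    then have 2: "prob ?A \<le> K * T * measure lborel ?A + B * T powr (- m)"
      using K T B by (subst (asm) ennreal_le_iff) (auto intro!: add_nonneg_nonneg)
    show ?thesis unfolding emeasure_eq_measure using 1 2 by (intro ennreal_leI) linarith
  qed

  \<comment> \<open>If \<open>F x > 2 * K\<close>, then the term of the last dyadic level below \<open>F x\<close> dominates \<open>F x\<close>.\<close>
  define g where "g j x = ennreal (2 * K * 2 ^ Suc j) * indicator {x. F x > 2 * K * 2 ^ j} x" for j :: nat and x
  have [measurable]: "g j \<in> borel_measurable borel" for j unfolding g_def by measurable
  have F_le: "ennreal (F x) \<le> ennreal (2 * K) + (\<Sum>j. g j x)" for x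
  proof (cases "F x \<le> 2 * K")
    case True
    then have "ennreal (F x) \<le> ennreal (2 * K)" by (rule ennreal_leI)
    also have "\<dots> \<le> ennreal (2 * K) + (\<Sum>j. g j x)" by simp
    finally show ?thesis .
  next
    case False
    have ex: "\<exists>j. F x \<le> 2 * K * 2 ^ j"
      using real_arch_pow[of 2 "F x / (2 * K)"] K by (auto simp: field_simps intro: less_imp_le)
    define j where "j = (LEAST j. F x \<le> 2 * K * 2 ^ j)"
    have j1: "F x \<le> 2 * K * 2 ^ j" unfolding j_def by (rule LeastI_ex[OF ex])
    with False obtain i where i: "j = Suc i" by (cases j) auto
    have "i < (LEAST j. F x \<le> 2 * K * 2 ^ j)" using i j_def by simp
    then have "\<not> F x \<le> 2 * K * 2 ^ i" by (rule not_less_Least)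
    then have "ennreal (F x) \<le> g i x" using j1 i by (auto simp: g_def intro!: ennreal_leI)
    also have "g i x \<le> (\<Sum>j. g j x)"
      using sum_le_suminf[of "\<lambda>j. g j x" "{i}"] by simp
    also have "\<dots> \<le> ennreal (2 * K) + (\<Sum>j. g j x)" by simp
    finally show ?thesis .
  qed
  define q where "q = 2 powr (1 - m)"
  have q: "0 \<le> q" "q < 1" unfolding q_def using m by (auto simp: powr_less_one)
  have g_int: "(\<integral>\<^sup>+x. g j x \<partial>\<nu>) \<le> ennreal (8 * K * B * q ^ j)" for j
  proof -
    have "(\<integral>\<^sup>+x. g j x \<partial>\<nu>) = ennreal (2 * K * 2 ^ Suc j) * emeasure \<nu> {x. F x > 2 * K * 2 ^ j}"
      unfolding g_def by (rule nn_integral_cmult_indicator) (simp add: sets)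
    also have "\<dots> \<le> ennreal (2 * K * 2 ^ Suc j) * ennreal (2 * B * (2 ^ j) powr (- m))"
      by (intro mult_left_mono tail) auto
    also have "\<dots> = ennreal (8 * K * B * (2 ^ j * (2 ^ j) powr (- m)))"
      using K B by (subst ennreal_mult[symmetric]) (auto simp: mult_ac)
    also have "2 ^ j * (2 ^ j) powr (- m) = q ^ j"
    proof -
      have "2 ^ j * (2 ^ j) powr (- m) = (2 powr real j) * (2 powr real j) powr (- m)"
        by (simp add: powr_realpow)
      also have "\<dots> = 2 powr (real j * (1 - m))"
        by (simp add: powr_powr powr_add[symmetric] algebra_simps)
      also have "\<dots> = q ^ j" unfolding q_def by (simp add: powr_powr powr_realpow[symmetric] mult.commute)
      finally show ?thesis .
    qed
    finally show ?thesis .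
  qed
  have "(\<integral>\<^sup>+x. ennreal ((F x)\<^sup>2) \<partial>lborel) = (\<integral>\<^sup>+x. ennreal (F x) * ennreal (F x) \<partial>lborel)"
    by (simp add: power2_eq_square ennreal_mult F0)
  also have "\<dots> = (\<integral>\<^sup>+x. ennreal (F x) \<partial>\<nu>)"
    by (subst dens) (simp add: nn_integral_density)
  also have "\<dots> \<le> (\<integral>\<^sup>+x. ennreal (2 * K) + (\<Sum>j. g j x) \<partial>\<nu>)"
    by (intro nn_integral_mono F_le)
  also have "\<dots> = ennreal (2 * K) + (\<Sum>j. \<integral>\<^sup>+x. g j x \<partial>\<nu>)"
    by (subst nn_integral_add) (auto simp: nn_integral_suminf emeasure_space_1)
  also have "\<dots> \<le> ennreal (2 * K) + (\<Sum>j. ennreal (8 * K * B * q ^ j))"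
    by (intro add_left_mono suminf_le g_int) auto
  also have "(\<Sum>j. ennreal (8 * K * B * q ^ j)) = ennreal (\<Sum>j. 8 * K * B * q ^ j)"
    using K B q by (intro suminf_ennreal2 summable_mult summable_geometric) auto
  also have "ennreal (2 * K) + ennreal (\<Sum>j. 8 * K * B * q ^ j) < \<infinity>" by simp
  finally show thesis using that[of F] dens F0 by simp
qed

text \<open>By \<open>smooth_fourier\<close>, \<open>\<integral>\<bar>cfun \<nu> t\<bar>\<^sup>2 exp (- s\<^sup>2 \<bar>t\<bar>\<^sup>2 / 2)\<close> is a constant times the mean of \<open>smooth \<nu> s\<close>
  under \<open>\<nu>\<close>. That mean is a double integral of \<open>F x * F y\<close> against the kernel, hence at most \<open>\<integral>F\<^sup>2\<close>
  because \<open>F x * F y \<le> ((F x)\<^sup>2 + (F y)\<^sup>2) / 2\<close>. Let \<open>s \<rightarrow> 0\<close> and use Fatou's lemma.\<close>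

lemma cfun_square_integrable:
  fixes F :: "'b::euclidean_space \<Rightarrow> real"
  assumes nu: "prob_space \<nu>" and [measurable]: "F \<in> borel_measurable borel" and F0: "\<And>x. 0 \<le> F x"
    and dens: "\<nu> = density lborel (\<lambda>x. ennreal (F x))"
    and fin: "(\<integral>\<^sup>+x. ennreal ((F x)\<^sup>2) \<partial>lborel) < \<infinity>"
  shows "(\<integral>\<^sup>+t. ennreal ((cmod (cfun \<nu> t))\<^sup>2) \<partial>lborel) < \<infinity>"
proof -
  interpret prob_space \<nu> by fact
  have sets [measurable_cong]: "sets \<nu> = sets borel" by (simp add: dens)
  have [measurable]: "cfun \<nu> \<in> borel_measurable borel" by (rule cfun_measurable[OF nu sets])
  let ?I = "\<integral>\<^sup>+x. ennreal ((F x)\<^sup>2) \<partial>lborel"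
  let ?c = "(2 * pi) ^ DIM('b)"
  have le1: "cmod (cfun \<nu> t) \<le> 1" for t
    by (rule cfun_le_1[OF nu sets])
  have shift: "(\<integral>\<^sup>+y. ennreal (gauss_kernel s (x - y)) \<partial>lborel) = 1" if s: "s > 0" for s and x :: 'b
  proof -
    have "(\<integral>\<^sup>+y. ennreal (gauss_kernel s (x - y)) \<partial>lborel) = (\<integral>\<^sup>+y. ennreal (gauss_kernel s (- x + y)) \<partial>lborel)"
      by (intro nn_integral_cong) (metis gauss_kernel_minus minus_diff_eq uminus_add_conv_diff)
    also have "\<dots> = (\<integral>\<^sup>+y. ennreal (gauss_kernel s y) \<partial>distr lborel borel ((+) (- x)))"
      by (subst nn_integral_distr) auto
    finally show ?thesis by (simp add: lborel_distr_plus nn_integral_gauss_kernel s)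
  qed
  have energy: "(\<integral>\<^sup>+x. ennreal (smooth \<nu> s x) \<partial>\<nu>) \<le> ?I" if s: "s > 0" for s
  proof -
    have int: "integrable \<nu> (\<lambda>y. gauss_kernel s (x - y))" for x
      by (rule integrable_const_bound) (auto intro!: AE_I2 gauss_kernel_le[OF s])
    have "(\<integral>\<^sup>+x. ennreal (smooth \<nu> s x) \<partial>\<nu>) = (\<integral>\<^sup>+x. \<integral>\<^sup>+y. ennreal (gauss_kernel s (x - y)) \<partial>\<nu> \<partial>\<nu>)"
      unfolding smooth_def by (intro nn_integral_cong nn_integral_eq_integral[symmetric] int) auto
    also have "\<dots> = (\<integral>\<^sup>+x. ennreal (F x) * (\<integral>\<^sup>+y. ennreal (F y) * ennreal (gauss_kernel s (x - y)) \<partial>lborel) \<partial>lborel)"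
      unfolding dens by (simp add: nn_integral_density)
    also have "\<dots> = (\<integral>\<^sup>+x. \<integral>\<^sup>+y. ennreal (F x * F y * gauss_kernel s (x - y)) \<partial>lborel \<partial>lborel)"
      by (simp add: nn_integral_cmult[symmetric] ennreal_mult[symmetric] F0 mult.assoc)
    also have "\<dots> \<le> (\<integral>\<^sup>+x. \<integral>\<^sup>+y. ennreal ((F x)\<^sup>2 / 2) * ennreal (gauss_kernel s (x - y))
        + ennreal ((F y)\<^sup>2 / 2) * ennreal (gauss_kernel s (x - y)) \<partial>lborel \<partial>lborel)"
    proof (intro nn_integral_mono)
      fix x y
      have "F x * F y \<le> (F x)\<^sup>2 / 2 + (F y)\<^sup>2 / 2"
        using sum_squares_bound[of "F x" "F y"] by simp
      then have "F x * F y * gauss_kernel s (x - y) \<le> ((F x)\<^sup>2 / 2 + (F y)\<^sup>2 / 2) * gauss_kernel s (x - y)"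
        by (rule mult_right_mono) simp
      then show "ennreal (F x * F y * gauss_kernel s (x - y)) \<le> ennreal ((F x)\<^sup>2 / 2) * ennreal (gauss_kernel s (x - y))
        + ennreal ((F y)\<^sup>2 / 2) * ennreal (gauss_kernel s (x - y))"
        by (simp add: ennreal_mult[symmetric] ennreal_plus[symmetric] distrib_right ennreal_leI del: ennreal_plus)
    qed
    also have "\<dots> = (\<integral>\<^sup>+x. \<integral>\<^sup>+y. ennreal ((F x)\<^sup>2 / 2) * ennreal (gauss_kernel s (x - y)) \<partial>lborel \<partial>lborel)
       + (\<integral>\<^sup>+x. \<integral>\<^sup>+y. ennreal ((F y)\<^sup>2 / 2) * ennreal (gauss_kernel s (x - y)) \<partial>lborel \<partial>lborel)"
      by (simp add: nn_integral_add)
    also have "(\<integral>\<^sup>+x. \<integral>\<^sup>+y. ennreal ((F x)\<^sup>2 / 2) * ennreal (gauss_kernel s (x - y)) \<partial>lborel \<partial>lborel)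
       = (\<integral>\<^sup>+x. ennreal ((F x)\<^sup>2 / 2) \<partial>lborel)"
      by (simp add: nn_integral_cmult shift[OF s])
    also have "(\<integral>\<^sup>+x. \<integral>\<^sup>+y. ennreal ((F y)\<^sup>2 / 2) * ennreal (gauss_kernel s (x - y)) \<partial>lborel \<partial>lborel)
       = (\<integral>\<^sup>+y. \<integral>\<^sup>+x. ennreal ((F y)\<^sup>2 / 2) * ennreal (gauss_kernel s (x - y)) \<partial>lborel \<partial>lborel)"
      by (rule lborel_pair.Fubini') measurable
    also have "\<dots> = (\<integral>\<^sup>+y. ennreal ((F y)\<^sup>2 / 2) \<partial>lborel)"
      by (subst gauss_kernel_minus[symmetric]) (simp add: nn_integral_cmult shift[OF s])
    also have "(\<integral>\<^sup>+x. ennreal ((F x)\<^sup>2 / 2) \<partial>lborel) + (\<integral>\<^sup>+y. ennreal ((F y)\<^sup>2 / 2) \<partial>lborel) = ?I"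
      by (simp add: nn_integral_add[symmetric] ennreal_plus[symmetric] del: ennreal_plus)
    finally show ?thesis .
  qed
  have key: "(\<integral>\<^sup>+t. ennreal (exp (- (s * norm t)\<^sup>2 / 2) * (cmod (cfun \<nu> t))\<^sup>2) \<partial>lborel) \<le> ennreal ?c * ?I"
    if s: "s > 0" for s
  proof -
    interpret P: pair_sigma_finite \<nu> lborel ..
    let ?e = "\<lambda>t :: 'b. exp (- (s * norm t)\<^sup>2 / 2)"
    have e_int: "integrable lborel ?e" by (rule integrable_gauss_exp[OF s])
    have int: "integrable (\<nu> \<Otimes>\<^sub>M lborel) (\<lambda>(x, t). complex_of_real (?e t) * (iexp (- (t \<bullet> x)) * cfun \<nu> t))"
    proof (rule P.Fubini_integrable)
      show "(\<lambda>(x, t). complex_of_real (?e t) * (iexp (- (t \<bullet> x)) * cfun \<nu> t)) \<in> borel_measurable (\<nu> \<Otimes>\<^sub>M lborel)"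
        by measurable
      have b: "integrable lborel (\<lambda>t. ?e t * cmod (cfun \<nu> t))"
        by (rule Bochner_Integration.integrable_bound[OF e_int]) (auto simp: mult_left_le le1)
      show "integrable \<nu> (\<lambda>x. \<integral>t. norm (case (x, t) of (x, t) \<Rightarrow> complex_of_real (?e t) * (iexp (- (t \<bullet> x)) * cfun \<nu> t)) \<partial>lborel)"
        by (simp add: norm_mult)
      show "AE x in \<nu>. integrable lborel (\<lambda>t. case (x, t) of (x, t) \<Rightarrow> complex_of_real (?e t) * (iexp (- (t \<bullet> x)) * cfun \<nu> t))"
        by (intro AE_I2, simp only: split, rule Bochner_Integration.integrable_bound[OF b]) (auto simp: norm_mult)
    qed
    have cnj: "cnj (cfun \<nu> t) = (CLINT x|\<nu>. iexp (- (t \<bullet> x)))" for t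
    proof -
      have "cnj (cfun \<nu> t) = (CLINT x|\<nu>. cnj (iexp (t \<bullet> x)))"
        unfolding cfun_def by (rule Bochner_Integration.integral_cnj[symmetric])
      then show ?thesis by (simp add: exp_cnj)
    qed
    have sm_int: "integrable \<nu> (smooth \<nu> s)"
    proof (rule integrableI_nonneg)
      show "smooth \<nu> s \<in> borel_measurable \<nu>" unfolding smooth_def by measurable
      show "(\<integral>\<^sup>+x. ennreal (smooth \<nu> s x) \<partial>\<nu>) < \<infinity>" using energy[OF s] fin by (rule le_less_trans)
    qed (auto simp: smooth_nonneg)
    have "complex_of_real (?c * (LINT x|\<nu>. smooth \<nu> s x)) = (CLINT x|\<nu>. complex_of_real ?c * complex_of_real (smooth \<nu> s x))"
      using sm_int by simp
    also have "\<dots> = (CLINT x|\<nu>. CLINT t|lborel. complex_of_real (?e t) * (iexp (- (t \<bullet> x)) * cfun \<nu> t))"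
      by (simp only: smooth_fourier[OF nu sets s])
    also have "\<dots> = (CLINT t|lborel. CLINT x|\<nu>. complex_of_real (?e t) * (iexp (- (t \<bullet> x)) * cfun \<nu> t))"
      by (rule P.Fubini_integral[OF int, symmetric])
    also have "\<dots> = (CLINT t|lborel. complex_of_real (?e t * (cmod (cfun \<nu> t))\<^sup>2))"
    proof (rule Bochner_Integration.integral_cong[OF refl])
      fix t
      have "(CLINT x|\<nu>. complex_of_real (?e t) * (iexp (- (t \<bullet> x)) * cfun \<nu> t)) = complex_of_real (?e t) * (cnj (cfun \<nu> t) * cfun \<nu> t)"
        unfolding cnj by (simp only: integral_mult_right_zero integral_mult_left_zero)
      also have "cnj (cfun \<nu> t) * cfun \<nu> t = complex_of_real ((cmod (cfun \<nu> t))\<^sup>2)"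
        by (metis complex_norm_square mult.commute)
      finally show "(CLINT x|\<nu>. complex_of_real (?e t) * (iexp (- (t \<bullet> x)) * cfun \<nu> t)) = complex_of_real (?e t * (cmod (cfun \<nu> t))\<^sup>2)"
        by simp
    qed
    finally have eq: "?c * (LINT x|\<nu>. smooth \<nu> s x) = (LINT t|lborel. ?e t * (cmod (cfun \<nu> t))\<^sup>2)"
      by (simp only: integral_complex_of_real of_real_eq_iff)
    have "integrable lborel (\<lambda>t. ?e t * (cmod (cfun \<nu> t))\<^sup>2)"
      by (rule Bochner_Integration.integrable_bound[OF e_int]) (auto simp: mult_left_le le1 power_le_one)
    then have "(\<integral>\<^sup>+t. ennreal (?e t * (cmod (cfun \<nu> t))\<^sup>2) \<partial>lborel) = ennreal (LINT t|lborel. ?e t * (cmod (cfun \<nu> t))\<^sup>2)"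
      by (rule nn_integral_eq_integral) simp
    also have "\<dots> = ennreal ?c * (\<integral>\<^sup>+x. ennreal (smooth \<nu> s x) \<partial>\<nu>)"
      unfolding eq[symmetric] by (subst nn_integral_eq_integral[OF sm_int]) (auto simp: ennreal_mult smooth_nonneg)
    also have "\<dots> \<le> ennreal ?c * ?I" by (intro mult_left_mono energy s) simp
    finally show ?thesis .
  qed
  let ?u = "\<lambda>n t. ennreal (exp (- ((1 / real (Suc n)) * norm t)\<^sup>2 / 2) * (cmod (cfun \<nu> t))\<^sup>2)"
  have lim0: "(\<lambda>n. 1 / real (Suc n)) \<longlonglongrightarrow> 0" by (rule LIMSEQ_Suc[OF lim_1_over_n])
  have lim: "liminf (\<lambda>n. ?u n t) = ennreal ((cmod (cfun \<nu> t))\<^sup>2)" for t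
  proof -
    have "(\<lambda>n. ?u n t) \<longlonglongrightarrow> ennreal (exp (- (0 * norm t)\<^sup>2 / 2) * (cmod (cfun \<nu> t))\<^sup>2)"
      by (intro tendsto_ennrealI tendsto_intros lim0) auto
    then have "(\<lambda>n. ?u n t) \<longlonglongrightarrow> ennreal ((cmod (cfun \<nu> t))\<^sup>2)" by simp
    then show ?thesis by (rule lim_imp_Liminf[OF sequentially_bot])
  qed
  have "(\<integral>\<^sup>+t. ennreal ((cmod (cfun \<nu> t))\<^sup>2) \<partial>lborel) = (\<integral>\<^sup>+t. liminf (\<lambda>n. ?u n t) \<partial>lborel)"
    by (simp only: lim)
  also have "\<dots> \<le> liminf (\<lambda>n. \<integral>\<^sup>+t. ?u n t \<partial>lborel)"
    by (rule nn_integral_liminf) measurable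
  also have "\<dots> \<le> liminf (\<lambda>n :: nat. ennreal ?c * ?I)"
    by (intro Liminf_mono always_eventually allI key) simp
  also have "\<dots> = ennreal ?c * ?I" by (rule Liminf_const) simp
  also have "\<dots> < \<infinity>" using fin by (simp add: ennreal_mult_less_top)
  finally show ?thesis .
qed

lemma (in prob_space) normalized_sum_measurable:
  fixes X :: "nat \<Rightarrow> 'a \<Rightarrow> 'b::euclidean_space"
  assumes indep: "indep_vars (\<lambda>_. borel) X {1..}"
  shows "normalized_sum X n \<in> borel_measurable M"
proof -
  have [measurable]: "X i \<in> borel_measurable M" if "i \<in> {1..n}" for i
    using indep that unfolding indep_vars_def2 by auto
  show ?thesis unfolding normalized_sum_def by measurable
qed

lemma (in prob_space) cfun_normalized_sum:
  fixes X :: "nat \<Rightarrow> 'a \<Rightarrow> 'b::euclidean_space"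
  assumes indep: "indep_vars (\<lambda>_. borel) X {1..}"
    and law: "\<And>i. i \<ge> 1 \<Longrightarrow> distr M borel (X i) = \<mu>"
  shows "cfun (distr M borel (normalized_sum X n)) t = cfun \<mu> ((1 / sqrt (real n)) *\<^sub>R t) ^ n"
proof -
  have "normalized_sum X n = (\<lambda>\<omega>. (1 / sqrt (real n)) *\<^sub>R (\<Sum>i\<in>{1..n}. X i \<omega>))"
    by (auto simp: normalized_sum_def inverse_eq_divide)
  then show ?thesis
    using cfun_scaled_sum[OF indep_vars_subset[OF indep], of "{1..n}" \<mu> "1 / sqrt (real n)" t] law by auto
qed

text \<open>Consecutive blocks of length \<open>n\<close> give independent copies of the \<open>n\<close>-th normalized sum. The sum of \<open>k\<close>
  of them, with \<open>k (r - 1) > 1\<close>, has a square integrable characteristic function, and this function is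
  \<open>t \<mapsto> cfun \<mu> (t / \<surd>n) ^ (n * k)\<close>.\<close>

theorem (in prob_space) power_integrable_density_imp_power_integrable_cfun:
  fixes X :: "nat \<Rightarrow> 'a \<Rightarrow> 'b::euclidean_space" and f :: "'b \<Rightarrow> real"
  assumes indep: "indep_vars (\<lambda>_. borel) X {1..}"
    and law: "\<And>i. i \<ge> 1 \<Longrightarrow> distr M borel (X i) = \<mu>"
    and n: "n \<ge> 1" and r: "r > 1" and [measurable]: "f \<in> borel_measurable borel"
    and dens: "distr M borel (normalized_sum X n) = density lborel (\<lambda>x. ennreal (f x))"
    and fin: "(\<integral>\<^sup>+x. ennreal (f x powr r) \<partial>lborel) < \<infinity>"
  shows "\<exists>\<nu>\<ge>1. (\<integral>\<^sup>+t. ennreal (cmod (cfun \<mu> t) powr \<nu>) \<partial>lborel) < \<infinity>"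
proof -
  have Xm [measurable]: "X i \<in> borel_measurable M" if "i \<ge> 1" for i
    using indep that unfolding indep_vars_def2 by auto
  have mu: "prob_space \<mu>" "sets \<mu> = sets borel"
    unfolding law[of 1, simplified, symmetric] by (simp_all add: prob_space_distr)
  have [measurable]: "cfun \<mu> \<in> borel_measurable borel" by (rule cfun_measurable[OF mu])
  define c where "c = 1 / sqrt (real n)"
  have c: "c > 0" using n by (simp add: c_def)
  obtain k :: nat where "1 / (r - 1) < real k" using reals_Archimedean2 by blast
  then have k: "real k * (r - 1) > 1" using r by (simp add: field_simps)
  then have k0: "k > 0" by (cases k) auto
  define D where "D j = {j * n + 1..Suc j * n}" for j
  have D_sub: "D j \<subseteq> {1..}" and D_card: "card (D j) = n" for j by (auto simp: D_def)
  have D_disj: "disjoint_family_on D {..<k}"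
    unfolding disjoint_family_on_def
  proof (intro ballI impI)
    fix i j :: nat assume "i \<noteq> j"
    have "D i \<inter> D j = {}" if "i < j" for i j
    proof -
      have "Suc i * n \<le> j * n" using that by (intro mult_right_mono) auto
      then show ?thesis by (auto simp: D_def)
    qed
    with \<open>i \<noteq> j\<close> show "D i \<inter> D j = {}" by (cases i j rule: linorder_cases) (auto simp: Int_commute)
  qed
  define Y where "Y j \<omega> = c *\<^sub>R (\<Sum>i\<in>D j. X i \<omega>)" for j \<omega>
  have "indep_vars (\<lambda>j. borel) (\<lambda>j \<omega>. c *\<^sub>R (\<Sum>i\<in>D j. (restrict (\<lambda>i. X i \<omega>) (D j)) i)) {..<k}"
    by (rule indep_vars_compose2[OF indep_vars_restrict[OF indep D_sub D_disj],
        where Y = "\<lambda>j f. c *\<^sub>R (\<Sum>i\<in>D j. f i)"]) auto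
  then have Y_indep: "indep_vars (\<lambda>_. borel) Y {..<k}"
    unfolding Y_def by (simp cong: sum.cong)
  have Ym [measurable]: "Y j \<in> borel_measurable M" if "j < k" for j
    using Y_indep that unfolding indep_vars_def2 by auto
  have Y_cfun: "cfun (distr M borel (Y j)) t = cfun \<mu> (c *\<^sub>R t) ^ n" for j t
    unfolding Y_def[abs_def]
    using cfun_scaled_sum[OF indep_vars_subset[OF indep D_sub], of j \<mu> c t] law D_sub D_card by auto
  note [measurable] = normalized_sum_measurable[OF indep, of n]
  have Z_cfun: "cfun (distr M borel (normalized_sum X n)) t = cfun \<mu> (c *\<^sub>R t) ^ n" for t
    unfolding c_def by (rule cfun_normalized_sum[OF indep law])
  \<comment> \<open>All blocks have the law of the normalized sum, since their characteristic functions agree.\<close>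
  have Y_law: "distr M borel (Y j) = density lborel (\<lambda>x. ennreal (f x))" if j: "j < k" for j
  proof -
    have "distr M borel (Y j) = distr M borel (normalized_sum X n)"
      using j by (intro cfun_unique) (auto intro!: prob_space_distr simp: Y_cfun Z_cfun)
    then show ?thesis by (simp add: dens)
  qed
  define \<kappa> where "\<kappa> = distr M borel (\<lambda>\<omega>. \<Sum>j<k. Y j \<omega>)"
  have kappa: "prob_space \<kappa>" "sets \<kappa> = sets borel"
    unfolding \<kappa>_def by (auto intro!: prob_space_distr)
  have kappa_cfun: "cfun \<kappa> t = cfun \<mu> (c *\<^sub>R t) ^ (n * k)" for t
    using cfun_scaled_sum[OF Y_indep Y_law, of 1 t] k0
    by (simp add: \<kappa>_def Y_law[OF k0, symmetric] Y_cfun power_mult)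
  obtain I where I: "(\<integral>\<^sup>+x. ennreal (f x powr r) \<partial>lborel) = ennreal I" "I \<ge> 0"
    using fin by (cases "\<integral>\<^sup>+x. ennreal (f x powr r) \<partial>lborel") auto
  have conc: "emeasure \<kappa> A \<le> ennreal (real k * T) * emeasure lborel A + ennreal (I ^ k * T powr (- (real k * (r - 1))))"
    if T: "T > 0" and A: "A \<in> sets borel" for T A
  proof -
    let ?d = "emeasure (density lborel (\<lambda>x. ennreal (f x))) {x. f x > T}"
    have "?d \<le> ennreal (T powr (1 - r) * I)"
      using tail_le_power_integral[OF r, of f T] T I by (simp add: ennreal_mult)
    then have "?d ^ k \<le> ennreal (T powr (1 - r) * I) ^ k" by (rule power_mono) simp
    also have "\<dots> = ennreal (I ^ k * T powr (- (real k * (r - 1))))"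
      using T I by (simp add: ennreal_power power_mult_distrib powr_power mult.commute algebra_simps)
    finally have "?d ^ k \<le> ennreal (I ^ k * T powr (- (real k * (r - 1))))" .
    moreover have "emeasure \<kappa> A \<le> of_nat k * (ennreal T * emeasure lborel A) + ?d ^ k"
      unfolding \<kappa>_def by (rule iid_sum_concentration[OF Y_indep k0 _ A Y_law]) auto
    moreover have "of_nat k * (ennreal T * emeasure lborel A) = ennreal (real k * T) * emeasure lborel A"
      using T by (simp add: ennreal_mult ennreal_of_nat_eq_real_of_nat mult.assoc)
    ultimately show ?thesis by (auto intro: order_trans add_left_mono)
  qed
  obtain F where F: "F \<in> borel_measurable borel" "\<And>x. 0 \<le> F x"
    "\<kappa> = density lborel (\<lambda>x. ennreal (F x))" "(\<integral>\<^sup>+x. ennreal ((F x)\<^sup>2) \<partial>lborel) < \<infinity>"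
  proof (rule square_integrable_density_of_concentration[OF kappa _ _ k])
    show "real k > 0" "I ^ k \<ge> 0" using k0 I by auto
  qed (use conc in blast)+
  have "(\<integral>\<^sup>+t. ennreal ((cmod (cfun \<kappa> t))\<^sup>2) \<partial>lborel) < \<infinity>"
    by (rule cfun_square_integrable[OF kappa(1) F])
  also have "(\<lambda>t. ennreal ((cmod (cfun \<kappa> t))\<^sup>2)) = (\<lambda>t. ennreal (cmod (cfun \<mu> (c *\<^sub>R t)) powr real (n * k * 2)))"
    using k0 n by (subst powr_realpow') (auto simp: kappa_cfun norm_power power_mult)
  finally have "(\<integral>\<^sup>+t. ennreal (cmod (cfun \<mu> t) powr real (n * k * 2)) \<partial>lborel) < \<infinity>"
    using c by (subst nn_integral_lborel_scaleR[where c = c]) (auto simp: ennreal_mult_less_top)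
  moreover have "real (n * k * 2) \<ge> 1"
    using n k0 by (metis Suc_leI One_nat_def less_le_trans mult_pos_pos of_nat_1 of_nat_le_iff pos2 zero_less_one)
  ultimately show ?thesis by blast
qed

section \<open>The central limit theorem for characteristic functions in mean\<close>

text \<open>Along the line through \<open>t\<close> this is the one-dimensional central limit theorem. The second order
  expansion of the characteristic function at 0 is compared with \<open>(1 - q / (2 n)) ^ n\<close>, where \<open>q\<close> is
  the variance along \<open>t\<close>; this covers \<open>q = 0\<close> as well.\<close>

lemma clt_cfun:
  fixes \<mu> :: "'b::euclidean_space measure"
  assumes "prob_space \<mu>" and [measurable_cong]: "sets \<mu> = sets borel"
    and int: "integrable \<mu> (\<lambda>x. t \<bullet> x)" and mean: "(LINT x|\<mu>. t \<bullet> x) = 0"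
    and int2: "integrable \<mu> (\<lambda>x. (t \<bullet> x)\<^sup>2)"
  shows "(\<lambda>n. cfun \<mu> ((1 / sqrt (real n)) *\<^sub>R t) ^ n) \<longlonglongrightarrow> exp (- (LINT x|\<mu>. (t \<bullet> x)\<^sup>2) / 2)"
proof -
  interpret prob_space \<mu> by fact
  define q where "q = (LINT x|\<mu>. (t \<bullet> x)\<^sup>2)"
  have q: "q \<ge> 0" unfolding q_def by (intro Bochner_Integration.integral_nonneg) auto
  define L where "L = distr \<mu> borel (\<lambda>x. t \<bullet> x)"
  interpret L: real_distribution L unfolding L_def by (rule real_distribution_distr) simp
  have L_int: "integrable L (\<lambda>x. x)" "L.expectation (\<lambda>x. x) = 0" "integrable L (\<lambda>x. x\<^sup>2)"
    using int mean int2 by (simp_all add: L_def integrable_distr_eq integral_distr)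
  have L_var: "L.variance (\<lambda>x. x) = q"
    using L_int(2) by (simp add: L_def integral_distr q_def)
  have char_eq: "cfun \<mu> (a *\<^sub>R t) = char L a" for a
    unfolding cfun_def char_def L_def by (subst integral_distr) auto
  define e where "e n = L.expectation (\<lambda>x. min (6 * x\<^sup>2) (\<bar>1 / sqrt (real n)\<bar> * \<bar>x\<bar> ^ 3))" for n
  have main: "cmod (char L (1 / sqrt (real n)) ^ n - complex_of_real ((1 + (- q / 2) / real n) ^ n)) \<le> e n / 6"
    if n: "n > 0" "real n \<ge> q / 4" for n :: nat
  proof -
    have sq: "(1 / sqrt (real n))\<^sup>2 = 1 / real n" using n by (simp add: power_divide)
    have "cmod (char L (1 / sqrt (real n)) - (1 - (1 / sqrt (real n))\<^sup>2 * q / 2))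
        \<le> ((1 / sqrt (real n))\<^sup>2 / 6) * e n"
      unfolding e_def by (rule L.char_approx3[OF L_int L_var])
    then have 1: "cmod (char L (1 / sqrt (real n)) - complex_of_real (1 + (- q / 2) / real n)) \<le> (1 / real n / 6) * e n"
      unfolding sq by (simp add: mult.commute)
    have "\<bar>1 + (- q / 2) / real n\<bar> \<le> 1" using n q by (auto simp: abs_le_iff field_simps)
    then have "cmod (complex_of_real (1 + (- q / 2) / real n)) \<le> 1" by (simp only: norm_of_real)
    then have "cmod (char L (1 / sqrt (real n)) ^ n - complex_of_real (1 + (- q / 2) / real n) ^ n)
        \<le> n * cmod (char L (1 / sqrt (real n)) - complex_of_real (1 + (- q / 2) / real n))"
      by (intro norm_power_diff L.cmod_char_le_1)
    also have "\<dots> \<le> real n * ((1 / real n / 6) * e n)" by (intro mult_left_mono 1) auto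
    also have "\<dots> = e n / 6" using n by simp
    finally show ?thesis by simp
  qed
  have "e \<longlonglongrightarrow> L.expectation (\<lambda>x. 0)" unfolding e_def
  proof (rule integral_dominated_convergence[where w = "\<lambda>x. 6 * x\<^sup>2"])
    show "AE x in L. (\<lambda>n. min (6 * x\<^sup>2) (\<bar>1 / sqrt (real n)\<bar> * \<bar>x\<bar> ^ 3)) \<longlonglongrightarrow> 0"
    proof (rule AE_I2)
      fix x :: real
      have "(\<lambda>n. \<bar>1 / sqrt (real n)\<bar> * \<bar>x\<bar> ^ 3) \<longlonglongrightarrow> 0 * \<bar>x\<bar> ^ 3"
        by (intro tendsto_mult tendsto_const) real_asymp
      then have "(\<lambda>n. min (6 * x\<^sup>2) (\<bar>1 / sqrt (real n)\<bar> * \<bar>x\<bar> ^ 3)) \<longlonglongrightarrow> min (6 * x\<^sup>2) (0 * \<bar>x\<bar> ^ 3)"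
        by (intro tendsto_min tendsto_const)
      then show "(\<lambda>n. min (6 * x\<^sup>2) (\<bar>1 / sqrt (real n)\<bar> * \<bar>x\<bar> ^ 3)) \<longlonglongrightarrow> 0" by simp
    qed
  qed (use L_int(3) in auto)
  then have "(\<lambda>n. e n / 6) \<longlonglongrightarrow> 0" by (auto intro: tendsto_divide_zero)
  moreover have "\<forall>\<^sub>F n in sequentially.
      cmod (char L (1 / sqrt (real n)) ^ n - complex_of_real ((1 + (- q / 2) / real n) ^ n)) \<le> e n / 6"
    using eventually_gt_at_top[of 0] eventually_ge_at_top[of "nat \<lceil>q / 4\<rceil>"]
    by eventually_elim (rule main, simp_all add: nat_ceiling_le_eq)
  ultimately have "(\<lambda>n. char L (1 / sqrt (real n)) ^ n - complex_of_real ((1 + (- q / 2) / real n) ^ n)) \<longlonglongrightarrow> 0"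
    by (rule Lim_null_comparison[rotated])
  moreover have "(\<lambda>n. complex_of_real ((1 + (- q / 2) / real n) ^ n)) \<longlonglongrightarrow> complex_of_real (exp (- q / 2))"
    by (rule isCont_tendsto_compose[OF _ tendsto_exp_limit_sequentially]) auto
  ultimately have "(\<lambda>n. char L (1 / sqrt (real n)) ^ n) \<longlonglongrightarrow> complex_of_real (exp (- q / 2))"
    by (rule Lim_transform[rotated])
  then show ?thesis by (simp add: char_eq q_def)
qed

text \<open>On the ball of radius \<open>R * sqrt n\<close> the bound of \<open>cfun_gaussian_bound\<close>, raised to the power \<open>n\<close>, is a
  Gaussian independent of \<open>n\<close>, so dominated convergence applies. Outside this ball \<open>\<bar>cfun \<mu>\<bar> \<le> 1/2\<close> at the
  rescaled point; all but \<open>\<nu>\<close> of the \<open>n\<close> factors are estimated by 1/2, the remaining ones are integrable,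
  and the factor \<open>2 powr (\<nu> - n)\<close> beats the Jacobian \<open>sqrt n ^ DIM('b)\<close> of the rescaling.\<close>

lemma local_limit_L1:
  fixes \<mu> :: "'b::euclidean_space measure" and g :: "'b \<Rightarrow> complex"
  assumes mu: "prob_space \<mu>" "sets \<mu> = sets borel" and int: "integrable \<mu> (\<lambda>x. x)"
    and nu: "\<nu> \<ge> 0" and fin: "(\<integral>\<^sup>+t. ennreal (cmod (cfun \<mu> t) powr \<nu>) \<partial>lborel) < \<infinity>"
    and lim: "\<And>t. (\<lambda>n. cfun \<mu> ((1 / sqrt (real n)) *\<^sub>R t) ^ n) \<longlonglongrightarrow> g t"
  shows "integrable lborel g"
    and "\<And>n. n > 0 \<Longrightarrow> real n \<ge> \<nu> \<Longrightarrow> integrable lborel (\<lambda>t. cfun \<mu> ((1 / sqrt (real n)) *\<^sub>R t) ^ n)"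
    and "(\<lambda>n. LINT t|lborel. cmod (cfun \<mu> ((1 / sqrt (real n)) *\<^sub>R t) ^ n - g t)) \<longlonglongrightarrow> 0"
proof -
  have [measurable]: "cfun \<mu> \<in> borel_measurable borel" by (rule cfun_measurable[OF mu])
  define \<phi> where "\<phi> n t = cfun \<mu> ((1 / sqrt (real n)) *\<^sub>R t) ^ n" for n t
  have [measurable]: "\<phi> n \<in> borel_measurable borel" for n unfolding \<phi>_def by measurable
  have [measurable]: "g \<in> borel_measurable borel"
    by (rule borel_measurable_LIMSEQ_metric[of \<phi>]) (auto simp: lim \<phi>_def)
  obtain R where R: "R > 0" "\<And>t. norm t \<ge> R \<Longrightarrow> cmod (cfun \<mu> t) \<le> 1 / 2"
    using cfun_small_at_infinity[OF mu int nu fin] by blast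
  define w where "w t = exp (- (norm t)\<^sup>2 / (8 * R\<^sup>2))" for t :: 'b
  have w_eq: "w = (\<lambda>t. exp (- ((1 / (2 * R)) * norm t)\<^sup>2 / 2))"
    unfolding w_def by (intro ext) (simp add: power_mult_distrib power_divide)
  have w_int: "integrable lborel w" unfolding w_eq using R(1) by (intro integrable_gauss_exp) auto
  have [measurable]: "w \<in> borel_measurable borel" unfolding w_def by measurable
  have w0: "0 \<le> w t" for t by (simp add: w_def)
  have near: "cmod (\<phi> n t) \<le> w t" if n: "n > 0" and t: "norm t \<le> R * sqrt (real n)" for n t
  proof -
    have "cmod (cfun \<mu> ((1 / sqrt (real n)) *\<^sub>R t)) \<le> exp (- (norm ((1 / sqrt (real n)) *\<^sub>R t))\<^sup>2 / (8 * R\<^sup>2))"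
      by (rule cfun_gaussian_bound[OF mu R]) (use n t in \<open>auto simp: field_simps\<close>)
    then have "cmod (\<phi> n t) \<le> exp (- (norm ((1 / sqrt (real n)) *\<^sub>R t))\<^sup>2 / (8 * R\<^sup>2)) ^ n"
      unfolding \<phi>_def norm_power by (rule power_mono) simp
    also have "\<dots> = w t" unfolding w_def exp_of_nat_mult[symmetric] using n
      by (simp add: power_divide)
    finally show ?thesis .
  qed
  have near_ev: "\<forall>\<^sub>F n in sequentially. n > 0 \<and> norm t \<le> R * sqrt (real n)" for t :: 'b
  proof -
    have "filterlim (\<lambda>n. R * sqrt (real n)) at_top sequentially" using R(1) by real_asymp
    then have "\<forall>\<^sub>F n in sequentially. norm t \<le> R * sqrt (real n)" by (simp add: filterlim_at_top)
    with eventually_gt_at_top[of 0] show ?thesis by eventually_elim auto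
  qed
  have g_le: "cmod (g t) \<le> w t" for t
  proof (rule tendsto_upperbound)
    show "(\<lambda>n. cmod (\<phi> n t)) \<longlonglongrightarrow> cmod (g t)" unfolding \<phi>_def by (intro tendsto_norm lim)
    show "\<forall>\<^sub>F n in sequentially. cmod (\<phi> n t) \<le> w t"
      using near_ev[of t] by eventually_elim (auto intro: near)
  qed simp
  show g_int: "integrable lborel g"
    by (rule Bochner_Integration.integrable_bound[OF w_int]) (auto simp: g_le w0)

  define near_part where "near_part n t = (if norm t \<le> R * sqrt (real n) then \<phi> n t else 0)" for n t
  define far_part where "far_part n t = (if norm t \<le> R * sqrt (real n) then 0 else cmod (\<phi> n t))" for n t
  have [measurable]: "near_part n \<in> borel_measurable borel" "far_part n \<in> borel_measurable borel" for n
    unfolding near_part_def far_part_def by measurable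
  have split: "cmod (\<phi> n t) = cmod (near_part n t) + far_part n t" for n t
    by (simp add: near_part_def far_part_def)
  have far0: "0 \<le> far_part n t" for n t by (simp add: far_part_def)
  obtain J where J: "(\<integral>\<^sup>+t. ennreal (cmod (cfun \<mu> t) powr \<nu>) \<partial>lborel) = ennreal J" "J \<ge> 0"
    using fin by (cases "\<integral>\<^sup>+t. ennreal (cmod (cfun \<mu> t) powr \<nu>) \<partial>lborel") auto
  \<comment> \<open>The bound for the outer part: Jacobian, exponential gain, and the integral of the power.\<close>
  define b where "b n = sqrt (real n) ^ DIM('b) * ((1 / 2) powr (real n - \<nu>) * J)" for n
  have far: "(\<integral>\<^sup>+t. ennreal (far_part n t) \<partial>lborel) \<le> ennreal (b n)" if n: "n > 0" "real n \<ge> \<nu>" for n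
  proof -
    have s: "sqrt (real n) > 0" using n by simp
    have "(\<integral>\<^sup>+t. ennreal (far_part n t) \<partial>lborel)
       = ennreal (sqrt (real n) ^ DIM('b)) * (\<integral>\<^sup>+t. ennreal (far_part n (sqrt (real n) *\<^sub>R t)) \<partial>lborel)"
      using s by (subst nn_integral_lborel_scaleR[of _ "sqrt (real n)"]) auto
    also have "(\<integral>\<^sup>+t. ennreal (far_part n (sqrt (real n) *\<^sub>R t)) \<partial>lborel)
       \<le> (\<integral>\<^sup>+t. ennreal ((1 / 2) powr (real n - \<nu>)) * ennreal (cmod (cfun \<mu> t) powr \<nu>) \<partial>lborel)"
    proof (rule nn_integral_mono)
      fix t :: 'b
      show "ennreal (far_part n (sqrt (real n) *\<^sub>R t))
          \<le> ennreal ((1 / 2) powr (real n - \<nu>)) * ennreal (cmod (cfun \<mu> t) powr \<nu>)"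
      proof (cases "norm t \<le> R")
        case True
        then show ?thesis using s by (simp add: far_part_def mult.commute)
      next
        case False
        let ?z = "cmod (cfun \<mu> t)"
        have "far_part n (sqrt (real n) *\<^sub>R t) = ?z ^ n"
          using False s by (simp add: far_part_def \<phi>_def norm_power mult.commute)
        also have "\<dots> = ?z powr (real n - \<nu>) * ?z powr \<nu>"
          using n by (simp add: powr_add[symmetric] powr_realpow')
        also have "\<dots> \<le> (1 / 2) powr (real n - \<nu>) * ?z powr \<nu>"
          using R(2)[of t] False n by (intro mult_right_mono powr_mono2) auto
        finally show ?thesis by (simp add: ennreal_mult[symmetric] ennreal_leI)
      qed
    qed
    also have "\<dots> = ennreal ((1 / 2) powr (real n - \<nu>) * J)"
      using J by (simp add: nn_integral_cmult ennreal_mult)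
    finally show ?thesis unfolding b_def using J
      by (simp add: ennreal_mult mult_left_mono)
  qed
  have far_int: "integrable lborel (far_part n)" if "n > 0" "real n \<ge> \<nu>" for n
    by (rule integrableI_nonneg) (use far[OF that] far0 in \<open>auto intro: le_less_trans\<close>)
  have phi_int: "integrable lborel (\<phi> n)" if n: "n > 0" "real n \<ge> \<nu>" for n
  proof (rule Bochner_Integration.integrable_bound[OF Bochner_Integration.integrable_add[OF w_int far_int[OF n]]])
    show "AE t in lborel. norm (\<phi> n t) \<le> norm (w t + far_part n t)"
      using near[OF n(1)] w0 by (intro AE_I2) (auto simp: far_part_def)
  qed simp
  then show "integrable lborel (\<lambda>t. cfun \<mu> ((1 / sqrt (real n)) *\<^sub>R t) ^ n)" if "n > 0" "real n \<ge> \<nu>" for n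
    using that by (simp add: \<phi>_def[abs_def])
  have near_le: "cmod (near_part n t) \<le> w t" if "n > 0" for n t
    using near[OF that, of t] w0[of t] by (simp add: near_part_def)
  have near_int: "integrable lborel (near_part n)" if "n > 0" for n
    by (rule Bochner_Integration.integrable_bound[OF w_int]) (use near_le[OF that] w0 in auto)

  have "(\<lambda>n. LINT t|lborel. cmod (near_part (Suc n) t - g t)) \<longlonglongrightarrow> (LINT t|(lborel :: 'b measure). (0 :: real))"
  proof (rule integral_dominated_convergence[where w = "\<lambda>t. 2 * w t"])
    show "AE t in lborel. (\<lambda>n. cmod (near_part (Suc n) t - g t)) \<longlonglongrightarrow> 0"
    proof (rule AE_I2)
      fix t :: 'b
      have "\<forall>\<^sub>F n in sequentially. \<phi> n t = near_part n t"
        using near_ev[of t] by eventually_elim (simp add: near_part_def)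
      then have "(\<lambda>n. near_part n t) \<longlonglongrightarrow> g t"
        using lim[of t] by (auto simp: \<phi>_def intro: Lim_transform_eventually)
      then have "(\<lambda>n. near_part (Suc n) t) \<longlonglongrightarrow> g t" by (rule LIMSEQ_Suc)
      then show "(\<lambda>n. cmod (near_part (Suc n) t - g t)) \<longlonglongrightarrow> 0"
        by (intro tendsto_norm_zero) (simp add: LIM_zero)
    qed
    show "AE t in lborel. norm (cmod (near_part (Suc n) t - g t)) \<le> 2 * w t" for n
    proof (rule AE_I2)
      fix t
      show "norm (cmod (near_part (Suc n) t - g t)) \<le> 2 * w t"
        using norm_triangle_ineq4[of "near_part (Suc n) t" "g t"] near_le[of "Suc n" t] g_le[of t] by simp
    qed
  qed (use w_int in auto)
  then have A: "(\<lambda>n. LINT t|lborel. cmod (near_part n t - g t)) \<longlonglongrightarrow> 0"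
    by (subst (asm) filterlim_sequentially_Suc) simp
  have B: "b \<longlonglongrightarrow> 0"
  proof -
    have "(\<lambda>n. (real n powr (real DIM('b) / 2)) * (1 / 2) powr (real n - \<nu>)) \<longlonglongrightarrow> 0" by real_asymp
    then have "(\<lambda>n. ((real n powr (real DIM('b) / 2)) * (1 / 2) powr (real n - \<nu>)) * J) \<longlonglongrightarrow> 0 * J"
      by (intro tendsto_mult tendsto_const)
    moreover have "\<forall>\<^sub>F n in sequentially. ((real n powr (real DIM('b) / 2)) * (1 / 2) powr (real n - \<nu>)) * J = b n"
      using eventually_gt_at_top[of 0]
      by eventually_elim (simp add: b_def powr_half_sqrt[symmetric] powr_powr powr_realpow[symmetric])
    ultimately show ?thesis by (auto intro: Lim_transform_eventually)
  qed
  have "(\<lambda>n. (LINT t|lborel. cmod (near_part n t - g t)) + b n) \<longlonglongrightarrow> 0"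
    using tendsto_add[OF A B] by simp
  moreover have "\<forall>\<^sub>F n in sequentially. norm (LINT t|lborel. cmod (\<phi> n t - g t))
      \<le> (LINT t|lborel. cmod (near_part n t - g t)) + b n"
    using eventually_gt_at_top[of 0] eventually_ge_at_top[of "nat \<lceil>\<nu>\<rceil>"]
  proof eventually_elim
    case (elim n)
    then have n: "n > 0" "real n \<ge> \<nu>" by (auto simp: nat_ceiling_le_eq)
    have "ennreal (LINT t|lborel. far_part n t) \<le> ennreal (b n)"
      using far[OF n] by (subst nn_integral_eq_integral[OF far_int[OF n], symmetric]) (auto simp: far0)
    moreover have "b n \<ge> 0" using J by (simp add: b_def)
    ultimately have far_b: "(LINT t|lborel. far_part n t) \<le> b n" by simp
    have i1: "integrable lborel (\<lambda>t. cmod (near_part n t - g t))"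
      by (intro integrable_norm Bochner_Integration.integrable_diff near_int g_int n)
    have "(LINT t|lborel. cmod (\<phi> n t - g t)) \<le> (LINT t|lborel. cmod (near_part n t - g t) + far_part n t)"
    proof (rule integral_mono)
      show "integrable lborel (\<lambda>t. cmod (\<phi> n t - g t))"
        by (intro integrable_norm Bochner_Integration.integrable_diff phi_int g_int n)
      show "cmod (\<phi> n t - g t) \<le> cmod (near_part n t - g t) + far_part n t" for t
        using norm_triangle_ineq4[of "\<phi> n t" "g t"] by (simp add: near_part_def far_part_def)
    qed (intro Bochner_Integration.integrable_add i1 far_int n)
    also have "\<dots> = (LINT t|lborel. cmod (near_part n t - g t)) + (LINT t|lborel. far_part n t)"
      by (rule Bochner_Integration.integral_add[OF i1 far_int[OF n]])
    finally show ?case using far_b by simp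
  qed
  ultimately show "(\<lambda>n. LINT t|lborel. cmod (cfun \<mu> ((1 / sqrt (real n)) *\<^sub>R t) ^ n - g t)) \<longlonglongrightarrow> 0"
    unfolding \<phi>_def[symmetric] by (rule Lim_null_comparison[rotated])
qed

section \<open>Convergence of power integrals\<close>

lemma powr_diff_le:
  fixes a b C r :: real
  assumes r: "r > 1" and "0 \<le> a" "0 \<le> b" "a \<le> C" "b \<le> C"
  shows "\<bar>a powr r - b powr r\<bar> \<le> r * C powr (r - 1) * \<bar>a - b\<bar>"
proof -
  have *: "y powr r - x powr r \<le> r * C powr (r - 1) * (y - x)" if xy: "0 \<le> x" "x < y" "y \<le> C" for x y
  proof -
    have "\<exists>l z. x < z \<and> z < y \<and> ((\<lambda>u. u powr r) has_real_derivative l) (at z) \<and> y powr r - x powr r = (y - x) * l"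
    proof (rule MVT[OF xy(2)])
      show "continuous_on {x..y} (\<lambda>u. u powr r)"
        using xy r by (intro continuous_on_powr' continuous_intros) auto
      show "(\<lambda>u. u powr r) differentiable (at z)" if "x < z" "z < y" for z
        using has_real_derivative_powr[of z r] that xy real_differentiable_def by fastforce
    qed
    then obtain l z where z: "x < z" "z < y" "((\<lambda>u. u powr r) has_real_derivative l) (at z)"
      "y powr r - x powr r = (y - x) * l" by blast
    have "l = r * z powr (r - 1)"
      using z(3) has_real_derivative_powr[of z r] z xy by (intro DERIV_unique) auto
    also have "\<dots> \<le> r * C powr (r - 1)"
      using z xy r by (intro mult_left_mono powr_mono2) auto
    finally show ?thesis using z(4) xy by (simp add: mult.commute mult_right_mono)
  qed
  show ?thesis
  proof (cases a b rule: linorder_cases)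
    case less
    then show ?thesis using *[of a b] powr_mono2[of r a b] assms by simp
  next
    case greater
    then show ?thesis using *[of b a] powr_mono2[of r b a] assms by simp
  qed (use assms in simp)
qed

lemma integrable_powr_bounded_density:
  fixes f :: "'b::euclidean_space \<Rightarrow> real"
  assumes r: "r > 1" and int: "integrable lborel f" and f: "\<And>x. 0 \<le> f x" "\<And>x. f x \<le> C"
  shows "integrable lborel (\<lambda>x. f x powr r)"
proof (rule Bochner_Integration.integrable_bound[OF integrable_mult_left[OF int, of "C powr (r - 1)"]])
  have [measurable]: "f \<in> borel_measurable borel" using borel_measurable_integrable[OF int] by simp
  show "(\<lambda>x. f x powr r) \<in> borel_measurable lborel" by measurable
  show "AE x in lborel. norm (f x powr r) \<le> norm (f x * C powr (r - 1))"
  proof (rule AE_I2)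
    fix x
    have "f x powr r = f x * f x powr (r - 1)"
      using f(1)[of x] r by (cases "f x = 0") (auto simp: powr_diff)
    also have "\<dots> \<le> f x * C powr (r - 1)"
      using f r by (intro mult_left_mono powr_mono2) auto
    finally show "norm (f x powr r) \<le> norm (f x * C powr (r - 1))" using f by simp
  qed
qed

text \<open>Scheffe's lemma turns pointwise convergence with equal masses into convergence in mean, and on a
  bounded interval \<open>x \<mapsto> x powr r\<close> is Lipschitz. Uniform closeness supplies both the pointwise
  convergence and the common bound.\<close>

lemma power_integral_tendsto:
  fixes f :: "nat \<Rightarrow> 'b::euclidean_space \<Rightarrow> real" and g :: "'b \<Rightarrow> real"
  assumes r: "r > 1" and int: "\<And>n. integrable lborel (f n)" "integrable lborel g"
    and f0: "\<And>n x. 0 \<le> f n x" and g0: "\<And>x. 0 \<le> g x" and gC: "\<And>x. g x \<le> C"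
    and mass: "\<And>n. (LINT x|lborel. f n x) = (LINT x|lborel. g x)"
    and close: "\<And>n x. \<bar>f n x - g x\<bar> \<le> e n" and e: "e \<longlonglongrightarrow> 0"
  shows "(\<lambda>n. LINT x|lborel. f n x powr r) \<longlonglongrightarrow> (LINT x|lborel. g x powr r)"
proof -
  have [measurable]: "f n \<in> borel_measurable borel" "g \<in> borel_measurable borel" for n
    using int[THEN borel_measurable_integrable] by simp_all
  obtain E where E: "\<And>n. \<bar>e n\<bar> \<le> E"
    using convergent_imp_Bseq[OF convergentI[OF e]] unfolding Bseq_def real_norm_def by blast
  have E0: "E \<ge> 0" using E[of 0] by simp
  have fC: "f n x \<le> C + E" for n x using close[of n x] gC[of x] E[of n] by linarith
  have gC': "g x \<le> C + E" for x using gC[of x] E0 by linarith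
  have pt: "(\<lambda>n. f n x) \<longlonglongrightarrow> g x" for x
  proof -
    have "(\<lambda>n. f n x - g x) \<longlonglongrightarrow> 0"
      by (rule Lim_null_comparison[OF _ e]) (simp add: close)
    then show ?thesis by (simp add: LIM_zero_iff)
  qed
  have "(\<lambda>n. \<integral>\<^sup>+x. norm (f n x - g x) \<partial>lborel) \<longlonglongrightarrow> 0"
  proof (rule Scheffe_lemma2[OF _ int(2)])
    show "(\<integral>\<^sup>+x. norm (f n x) \<partial>lborel) \<le> (\<integral>\<^sup>+x. norm (g x) \<partial>lborel)" for n
      using int mass[of n] by (simp add: f0 g0 nn_integral_eq_integral)
  qed (auto simp: pt)
  moreover have "(\<integral>\<^sup>+x. norm (f n x - g x) \<partial>lborel) = ennreal (LINT x|lborel. \<bar>f n x - g x\<bar>)" for n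
    using int by (subst nn_integral_eq_integral) auto
  ultimately have "(\<lambda>n. ennreal (LINT x|lborel. \<bar>f n x - g x\<bar>)) \<longlonglongrightarrow> ennreal 0" by simp
  then have L1: "(\<lambda>n. LINT x|lborel. \<bar>f n x - g x\<bar>) \<longlonglongrightarrow> 0"
    by (subst (asm) tendsto_ennreal_iff) auto
  let ?K = "r * (C + E) powr (r - 1)"
  have "(\<lambda>n. ?K * (LINT x|lborel. \<bar>f n x - g x\<bar>)) \<longlonglongrightarrow> 0"
    using tendsto_mult[OF tendsto_const L1, of ?K] by simp
  moreover have bound: "norm ((LINT x|lborel. f n x powr r) - (LINT x|lborel. g x powr r))
      \<le> ?K * (LINT x|lborel. \<bar>f n x - g x\<bar>)" for n
  proof -
    have i: "integrable lborel (\<lambda>x. f n x powr r)" "integrable lborel (\<lambda>x. g x powr r)"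
      by (rule integrable_powr_bounded_density[OF r]; (rule int f0 g0 fC gC'))+
    have "(LINT x|lborel. f n x powr r) - (LINT x|lborel. g x powr r) = (LINT x|lborel. f n x powr r - g x powr r)"
      by (rule Bochner_Integration.integral_diff[OF i, symmetric])
    also have "norm \<dots> \<le> (LINT x|lborel. ?K * \<bar>f n x - g x\<bar>)"
    proof (rule Bochner_Integration.integral_norm_bound_integral)
      show "norm (f n x powr r - g x powr r) \<le> ?K * \<bar>f n x - g x\<bar>" for x
        unfolding real_norm_def by (rule powr_diff_le[OF r f0 g0 fC gC'])
    qed (use i int in auto)
    finally show ?thesis by simp
  qed
  ultimately have "(\<lambda>n. (LINT x|lborel. f n x powr r) - (LINT x|lborel. g x powr r)) \<longlonglongrightarrow> 0"
    by (intro Lim_null_comparison[OF always_eventually[OF allI[OF bound]]])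
  then show ?thesis by (simp add: LIM_zero_iff)
qed

section \<open>Renyi entropies of bounded densities\<close>

lemma distr_lborel [simp]: "distr M lborel X = distr M borel X"
  by (rule distr_cong) auto

text \<open>A density of a probability law is finite almost everywhere, so real-valued densities suffice.\<close>

lemma (in prob_space) distributed_real_density:
  fixes X :: "'a \<Rightarrow> 'b::euclidean_space"
  assumes D: "distributed M lborel X \<rho>"
  shows "distr M borel X = density lborel (\<lambda>x. ennreal (enn2real (\<rho> x)))"
proof -
  have [measurable]: "\<rho> \<in> borel_measurable borel" and [measurable]: "X \<in> borel_measurable M"
    and eq: "distr M borel X = density lborel \<rho>"
    using D by (auto simp: distributed_def)
  interpret X: prob_space "distr M borel X" by (rule prob_space_distr) simp
  have "(\<integral>\<^sup>+x. \<rho> x \<partial>lborel) = emeasure (density lborel \<rho>) UNIV"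
    by (simp add: emeasure_density)
  also have "\<dots> = 1" using X.emeasure_space_1 unfolding eq by simp
  finally have "(\<integral>\<^sup>+x. \<rho> x \<partial>lborel) \<noteq> \<infinity>" by simp
  then have "AE x in lborel. \<rho> x \<noteq> \<infinity>" by (intro nn_integral_PInf_AE) auto
  then show ?thesis unfolding eq by (intro density_cong) (auto simp: less_top)
qed

lemma renyi_entropy_eq_log_power_integral:
  fixes X :: "'a \<Rightarrow> 'b::euclidean_space" and f :: "'b \<Rightarrow> real"
  assumes [measurable]: "f \<in> borel_measurable borel" and f0: "\<And>x. 0 \<le> f x"
    and dens: "distr M borel X = density lborel (\<lambda>x. ennreal (f x))"
  shows "renyi_entropy r M X = ereal (1 / (1 - r)) * ereal_log (\<integral>\<^sup>+x. ennreal (f x powr r) \<partial>lborel)"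
proof -
  have "AE x in lborel. ennreal (f x) = RN_deriv lborel (distr M borel X) x"
    by (rule sigma_finite_measure.RN_deriv_unique[OF lborel.sigma_finite_measure_axioms]) (auto simp: dens)
  then have "AE x in lborel. ennreal (enn2real (RN_deriv lborel (distr M borel X) x) powr r) = ennreal (f x powr r)"
    by eventually_elim (metis enn2real_ennreal f0)
  then have "(\<integral>\<^sup>+x. ennreal (enn2real (RN_deriv lborel (distr M borel X) x) powr r) \<partial>lborel)
      = (\<integral>\<^sup>+x. ennreal (f x powr r) \<partial>lborel)"
    by (rule nn_integral_cong_AE)
  then show ?thesis by (simp add: renyi_entropy_def)
qed

lemma power_integral_finite_if_renyi_finite:
  assumes "r > 1" and fin: "\<bar>ereal (1 / (1 - r)) * ereal_log I\<bar> \<noteq> \<infinity>"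
  shows "I < \<infinity>"
proof (rule ccontr)
  assume "\<not> I < \<infinity>"
  then have "I = top" by (simp add: top_unique not_less)
  then show False using assms by (simp add: ereal_log_def)
qed

text \<open>The power integral is finite because the density is bounded, and positive because the density has
  mass 1; so neither infinite value of the logarithm occurs.\<close>

lemma bounded_density_entropy:
  fixes X :: "'a \<Rightarrow> 'b::euclidean_space" and f :: "'b \<Rightarrow> real"
  assumes M: "prob_space M" and X: "X \<in> borel_measurable M" and r: "r > 1"
    and [measurable]: "f \<in> borel_measurable borel" and f: "\<And>x. 0 \<le> f x" "\<And>x. f x \<le> C"
    and dens: "distr M borel X = density lborel (\<lambda>x. ennreal (f x))"
  shows "integrable lborel f" "(LINT x|lborel. f x) = 1"
    and "(LINT x|lborel. f x powr r) > 0"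
    and "renyi_entropy r M X = ereal (1 / (1 - r) * ln (LINT x|lborel. f x powr r))"
proof -
  interpret P: prob_space "distr M borel X" by (rule prob_space.prob_space_distr[OF M X])
  have "(\<integral>\<^sup>+x. ennreal (f x) \<partial>lborel) = emeasure (distr M borel X) UNIV"
    unfolding dens by (simp add: emeasure_density)
  also have "\<dots> = 1" using P.emeasure_space_1 by simp
  finally have one: "(\<integral>\<^sup>+x. ennreal (f x) \<partial>lborel) = 1" .
  show int: "integrable lborel f" by (rule integrableI_nonneg) (auto simp: f one)
  show mass: "(LINT x|lborel. f x) = 1"
    by (subst integral_eq_nn_integral) (auto simp: f one)
  have int_r: "integrable lborel (\<lambda>x. f x powr r)"
    by (rule integrable_powr_bounded_density[OF r int f])
  show pos: "(LINT x|lborel. f x powr r) > 0"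
  proof (rule ccontr)
    assume "\<not> (LINT x|lborel. f x powr r) > 0"
    moreover have "(LINT x|lborel. f x powr r) \<ge> 0" by (intro Bochner_Integration.integral_nonneg) auto
    ultimately have "(LINT x|lborel. f x powr r) = 0" by simp
    then have "AE x in lborel. f x powr r = 0"
      by (subst (asm) integral_nonneg_eq_0_iff_AE[OF int_r]) auto
    then have "AE x in lborel. f x = 0" by eventually_elim simp
    then have "(LINT x|lborel. f x) = (LINT x|(lborel :: 'b measure). 0)"
      by (intro Bochner_Integration.integral_cong_AE) auto
    with mass show False by simp
  qed
  have "(\<integral>\<^sup>+x. ennreal (f x powr r) \<partial>lborel) = ennreal (LINT x|lborel. f x powr r)"
    by (rule nn_integral_eq_integral[OF int_r]) simp
  then show "renyi_entropy r M X = ereal (1 / (1 - r) * ln (LINT x|lborel. f x powr r))"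
    using pos by (subst renyi_entropy_eq_log_power_integral[OF _ f(1) dens]) (auto simp: ereal_log_def)
qed

section \<open>Gaussian vectors and second moments\<close>

text \<open>The variances of linear functionals of two vectors agree as soon as the covariance matrices do.\<close>

lemma second_moment_covariance:
  fixes X :: "'a \<Rightarrow> real ^ 'd"
  assumes M: "prob_space M" and cent: "centered M X" and cov: "finite_covariance M X"
  shows "integrable M (\<lambda>\<omega>. (t \<bullet> X \<omega>)\<^sup>2)"
    and "(LINT \<omega>|M. (t \<bullet> X \<omega>)\<^sup>2) = (\<Sum>i\<in>UNIV. \<Sum>j\<in>UNIV. t $ i * t $ j * covariance_matrix M X $ i $ j)"
proof -
  have zero: "(LINT \<omega>|M. X \<omega> $ i) = 0" for i
  proof -
    have "(LINT \<omega>|M. X \<omega> \<bullet> axis i 1) = (LINT \<omega>|M. X \<omega>) \<bullet> axis i 1"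
      using cent by (intro integral_inner_left) (auto simp: centered_def)
    then show ?thesis using cent by (simp add: centered_def inner_axis)
  qed
  have int: "integrable M (\<lambda>\<omega>. X \<omega> $ i * X \<omega> $ j)" for i j
    using cov by (simp add: finite_covariance_def zero)
  have sq: "(t \<bullet> X \<omega>)\<^sup>2 = (\<Sum>i\<in>UNIV. \<Sum>j\<in>UNIV. t $ i * t $ j * (X \<omega> $ i * X \<omega> $ j))" for \<omega>
    unfolding inner_vec_def power2_eq_square sum_product by (simp add: mult_ac)
  show "integrable M (\<lambda>\<omega>. (t \<bullet> X \<omega>)\<^sup>2)" unfolding sq by (intro Bochner_Integration.integrable_sum integrable_mult_right int)
  show "(LINT \<omega>|M. (t \<bullet> X \<omega>)\<^sup>2) = (\<Sum>i\<in>UNIV. \<Sum>j\<in>UNIV. t $ i * t $ j * covariance_matrix M X $ i $ j)"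
    unfolding sq by (simp add: int covariance_matrix_def zero)
qed

text \<open>The mean 0 of \<open>t \<bullet> Z\<close> identifies the location of its normal or point law, and the second moment its
  scale.\<close>

lemma gaussian_linear_functional:
  fixes Z :: "'a \<Rightarrow> 'b::euclidean_space"
  assumes N: "prob_space N" and gauss: "gaussian_vector N Z" and mean: "(LINT \<omega>|N. t \<bullet> Z \<omega>) = 0"
  shows "integrable N (\<lambda>\<omega>. (t \<bullet> Z \<omega>)\<^sup>2)"
    and "cfun (distr N borel Z) t = exp (- (LINT \<omega>|N. (t \<bullet> Z \<omega>)\<^sup>2) / 2)"
proof -
  have [measurable]: "Z \<in> borel_measurable N" using gauss by (simp add: gaussian_vector_def)
  define L where "L = distr N borel (\<lambda>\<omega>. t \<bullet> Z \<omega>)"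
  obtain m \<sigma> where \<sigma>: "\<sigma> \<ge> 0" and
    L: "L = (if \<sigma> = 0 then return borel m else density lborel (\<lambda>x. ennreal (normal_density m \<sigma> x)))"
    using gauss unfolding gaussian_vector_def L_def by blast
  have mean_L: "(LINT x|L. x) = 0" using mean by (simp add: L_def integral_distr)
  have cf: "cfun (distr N borel Z) t = (CLINT x|L. iexp x)"
    unfolding cfun_def L_def by (subst (1 2) integral_distr) auto
  have sq: "(LINT \<omega>|N. (t \<bullet> Z \<omega>)\<^sup>2) = (LINT x|L. x\<^sup>2)"
    unfolding L_def by (subst integral_distr) auto
  have sq_int: "integrable N (\<lambda>\<omega>. (t \<bullet> Z \<omega>)\<^sup>2) \<longleftrightarrow> integrable L (\<lambda>x. x\<^sup>2)"
    unfolding L_def by (subst integrable_distr_eq) auto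
  have "integrable L (\<lambda>x. x\<^sup>2) \<and> (CLINT x|L. iexp x) = exp (- (LINT x|L. x\<^sup>2) / 2)"
  proof (cases "\<sigma> = 0")
    case True
    then have L': "L = return borel m" using L by simp
    have "m = 0" using mean_L unfolding L' by (simp add: integral_return)
    moreover have "integrable (return borel m) (\<lambda>x. x\<^sup>2)"
      by (intro finite_measure.integrable_const_bound[where B = "m\<^sup>2"])
        (auto simp: prob_space.finite_measure prob_space_return AE_return)
    ultimately show ?thesis unfolding L' by (simp add: integral_return)
  next
    case False
    then have s: "\<sigma> > 0" using \<sigma> by simp
    have L': "L = density lborel (\<lambda>x. ennreal (normal_density m \<sigma> x))" using L False by simp
    have "m = (LINT x|L. x)" unfolding L'
      by (subst integral_density) (auto simp: integral_normal_moment_nz_1[OF s])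
    then have m: "m = 0" using mean_L by simp
    have "integrable L (\<lambda>x. x\<^sup>2)"
      unfolding L' m using integrable_normal_moment[OF s, of 0 2]
      by (subst integrable_density) auto
    moreover have "(LINT x|L. x\<^sup>2) = \<sigma>\<^sup>2"
      unfolding L' m using integral_normal_moment_even[OF s, of 0 1]
      by (subst integral_density) (auto simp: numeral_2_eq_2)
    moreover have "(CLINT x|L. iexp x) = exp (- \<sigma>\<^sup>2 / 2)"
      unfolding L' m using normal_density_fourier[OF s, of 1]
      by (subst integral_density) (auto simp: scaleR_conv_of_real)
    ultimately show ?thesis by simp
  qed
  then show "integrable N (\<lambda>\<omega>. (t \<bullet> Z \<omega>)\<^sup>2)" "cfun (distr N borel Z) t = exp (- (LINT \<omega>|N. (t \<bullet> Z \<omega>)\<^sup>2) / 2)"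
    unfolding sq_int cf sq by simp_all
qed

text \<open>Equality of covariance matrices says something about \<open>Z\<close> only if the entries of the matrix are
  integrals of integrable functions.\<close>

lemma gaussian_finite_covariance:
  fixes Z :: "'a \<Rightarrow> real ^ 'd"
  assumes N: "prob_space N" and gauss: "gaussian_vector N Z" and cent: "centered N Z"
  shows "finite_covariance N Z"
proof -
  have [measurable]: "Z \<in> borel_measurable N" using gauss by (simp add: gaussian_vector_def)
  have mean: "(LINT \<omega>|N. t \<bullet> Z \<omega>) = 0" for t
    using cent by (simp add: centered_def integral_inner_right)
  have sq: "integrable N (\<lambda>\<omega>. (Z \<omega> $ i)\<^sup>2)" for i
    using gaussian_linear_functional(1)[OF N gauss mean, of "axis i 1"] by (simp add: inner_axis')
  have prod: "integrable N (\<lambda>\<omega>. Z \<omega> $ i * Z \<omega> $ j)" for i j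
  proof (rule Bochner_Integration.integrable_bound[OF Bochner_Integration.integrable_add[OF sq sq]])
    have [measurable]: "(\<lambda>\<omega>. Z \<omega> $ i) \<in> borel_measurable N" for i
    proof -
      have "(\<lambda>\<omega>. axis i 1 \<bullet> Z \<omega>) \<in> borel_measurable N" by measurable
      then show ?thesis by (simp add: inner_axis')
    qed
    show "(\<lambda>\<omega>. Z \<omega> $ i * Z \<omega> $ j) \<in> borel_measurable N" by measurable
    show "AE \<omega> in N. norm (Z \<omega> $ i * Z \<omega> $ j) \<le> norm ((Z \<omega> $ i)\<^sup>2 + (Z \<omega> $ j)\<^sup>2)"
    proof (rule AE_I2)
      fix \<omega>
      have "2 * (\<bar>Z \<omega> $ i\<bar> * \<bar>Z \<omega> $ j\<bar>) \<le> (Z \<omega> $ i)\<^sup>2 + (Z \<omega> $ j)\<^sup>2"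
        using sum_squares_bound[of "\<bar>Z \<omega> $ i\<bar>" "\<bar>Z \<omega> $ j\<bar>"] by simp
      moreover have "0 \<le> \<bar>Z \<omega> $ i\<bar> * \<bar>Z \<omega> $ j\<bar>" by simp
      ultimately show "norm (Z \<omega> $ i * Z \<omega> $ j) \<le> norm ((Z \<omega> $ i)\<^sup>2 + (Z \<omega> $ j)\<^sup>2)"
        unfolding real_norm_def abs_mult by linarith
    qed
  qed
  have zero: "(LINT \<omega>|N. Z \<omega> $ i) = 0" for i
    using mean[of "axis i 1"] by (simp add: inner_axis')
  show ?thesis unfolding finite_covariance_def zero using prod by simp
qed

text \<open>If \<open>t \<bullet> Z\<close> had variance 0 for some \<open>t \<noteq> 0\<close>, then \<open>Z\<close> would lie in a hyperplane almost surely, which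
  a density excludes. So the variance form \<open>q\<close> is positive on the unit sphere, by compactness bounded
  below there, and \<open>exp (- q t / 2)\<close> is dominated by a Gaussian.\<close>

lemma gaussian_density_imp_integrable_cfun:
  fixes Z :: "'a \<Rightarrow> real ^ 'd"
  assumes N: "prob_space N" and gauss: "gaussian_vector N Z" and cent: "centered N Z"
    and dens: "has_density N Z"
  shows "integrable lborel (cfun (distr N borel Z))"
proof -
  interpret prob_space N by fact
  have [measurable]: "Z \<in> borel_measurable N" using gauss by (simp add: gaussian_vector_def)
  have law: "prob_space (distr N borel Z)" by (rule prob_space_distr) simp
  obtain \<rho> where \<rho>: "distributed N lborel Z \<rho>" using dens by (auto simp: has_density_def)
  have rho_eq: "distr N borel Z = density lborel \<rho>" and rho_meas: "\<rho> \<in> borel_measurable lborel"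
    using \<rho> by (simp_all add: distributed_def)
  have mean: "(LINT \<omega>|N. t \<bullet> Z \<omega>) = 0" for t
    using cent by (simp add: centered_def integral_inner_right)
  define q where "q t = (LINT \<omega>|N. (t \<bullet> Z \<omega>)\<^sup>2)" for t
  have q_int: "integrable N (\<lambda>\<omega>. (t \<bullet> Z \<omega>)\<^sup>2)" for t
    by (rule gaussian_linear_functional(1)[OF N gauss mean])
  have cf: "cfun (distr N borel Z) = (\<lambda>t. complex_of_real (exp (- q t / 2)))"
    unfolding q_def by (intro ext gaussian_linear_functional(2)[OF N gauss mean])
  have q_sum: "q t = (\<Sum>i\<in>UNIV. \<Sum>j\<in>UNIV. t $ i * t $ j * covariance_matrix N Z $ i $ j)" for t
    unfolding q_def by (rule second_moment_covariance(2)[OF N cent gaussian_finite_covariance[OF N gauss cent]])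
  have q_pos: "q t > 0" if t: "t \<noteq> 0" for t
  proof (rule ccontr)
    assume "\<not> q t > 0"
    moreover have "q t \<ge> 0" unfolding q_def by (intro Bochner_Integration.integral_nonneg) auto
    ultimately have "q t = 0" by simp
    then have "AE \<omega> in N. (t \<bullet> Z \<omega>)\<^sup>2 = 0"
      unfolding q_def by (subst (asm) integral_nonneg_eq_0_iff_AE[OF q_int]) auto
    then have "AE \<omega> in N. t \<bullet> Z \<omega> = 0" by eventually_elim simp
    then have "AE x in distr N borel Z. t \<bullet> x = 0" by (subst AE_distr_iff) auto
    then have ae: "AE x in lborel. \<rho> x > 0 \<longrightarrow> t \<bullet> x = 0"
      by (simp only: rho_eq AE_density[OF rho_meas])
    have "negligible {x. t \<bullet> x = 0}" using t by (intro negligible_hyperplane) simp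
    then have "{x. t \<bullet> x = 0} \<in> null_sets lebesgue" by (simp add: negligible_iff_null_sets)
    then have "{x. t \<bullet> x = 0} \<in> null_sets lborel" 
      using closed_hyperplane[of t 0] by (simp add: null_sets_def)
    then have "AE x in lborel. t \<bullet> x \<noteq> 0" using AE_not_in by fastforce
    with ae have "AE x in lborel. \<not> \<rho> x > 0" by eventually_elim simp
    then have "AE x in distr N borel Z. False"
      unfolding rho_eq AE_density[OF rho_meas] by simp
    then show False using prob_space.AE_False[OF law] by simp
  qed
  have q_cont: "continuous_on UNIV q"
    unfolding q_sum[abs_def] by (intro continuous_intros)
  have "compact (sphere (0 :: real ^ 'd) 1)" by simp
  moreover have "sphere (0 :: real ^ 'd) 1 \<noteq> {}" by simp
  ultimately obtain u where u: "u \<in> sphere 0 1" "\<And>t. t \<in> sphere 0 1 \<Longrightarrow> q u \<le> q t"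
    using continuous_attains_inf[of "sphere 0 1" q] continuous_on_subset[OF q_cont] by blast
  have qu: "q u > 0" using u by (intro q_pos) auto
  have q_scale: "q (a *\<^sub>R t) = a\<^sup>2 * q t" for a t
    unfolding q_def by (simp add: power_mult_distrib)
  have lower: "q u * (norm t)\<^sup>2 \<le> q t" for t
  proof (cases "t = 0")
    case False
    then have "q u \<le> q ((1 / norm t) *\<^sub>R t)" by (intro u(2)) simp
    then show ?thesis using False by (simp add: q_scale power_divide field_simps)
  qed (simp add: q_def)
  have "integrable lborel (\<lambda>t :: real ^ 'd. exp (- (sqrt (q u) * norm t)\<^sup>2 / 2))"
    using qu by (intro integrable_gauss_exp) simp
  then show ?thesis
  proof (rule Bochner_Integration.integrable_bound)
    show "cfun (distr N borel Z) \<in> borel_measurable lborel"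
      using cfun_measurable[OF law] by simp
    show "AE t in lborel. norm (cfun (distr N borel Z) t) \<le> norm (exp (- (sqrt (q u) * norm t)\<^sup>2 / 2))"
      using lower qu by (intro AE_I2) (simp add: cf power_mult_distrib)
  qed
qed

section \<open>Equivalence of the four conditions\<close>

lemma (in prob_space) bounded_density_of_integrable_cfun:
  fixes X :: "'a \<Rightarrow> 'b::euclidean_space"
  assumes X: "X \<in> borel_measurable M" and int: "integrable lborel (cfun (distr M borel X))"
  defines "f \<equiv> inv_fourier (cfun (distr M borel X))"
  shows "f \<in> borel_measurable borel" "0 \<le> f x"
    and "f x \<le> (LINT t|lborel. cmod (cfun (distr M borel X) t)) / (2 * pi) ^ DIM('b)"
    and "distr M borel X = density lborel (\<lambda>x. ennreal (f x))"
    and "distributed M lborel X (\<lambda>x. ennreal (f x))"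
proof -
  have law: "prob_space (distr M borel X)" "sets (distr M borel X) = sets borel"
    using X by (simp_all add: prob_space_distr)
  show meas [measurable]: "f \<in> borel_measurable borel"
    unfolding f_def using borel_measurable_integrable[OF int] by (intro inv_fourier_measurable) simp
  show "0 \<le> f x" unfolding f_def by (rule fourier_inversion(1)[OF law int])
  show "f x \<le> (LINT t|lborel. cmod (cfun (distr M borel X) t)) / (2 * pi) ^ DIM('b)"
    using inv_fourier_le[OF int, of x] unfolding f_def by linarith
  show dens: "distr M borel X = density lborel (\<lambda>x. ennreal (f x))"
    unfolding f_def by (rule fourier_inversion(2)[OF law int])
  show "distributed M lborel X (\<lambda>x. ennreal (f x))"
    unfolding distributed_def using dens X by simp
qed

text \<open>Convergence of the characteristic functions in mean makes the inverse transforms, which are the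
  densities, converge uniformly.\<close>

lemma entropy_convergence_of_integrable_cfun:
  fixes r :: real and X :: "nat \<Rightarrow> 'a \<Rightarrow> 'b::euclidean_space" and Z :: "'c \<Rightarrow> 'b"
  assumes r: "r > 1" and M: "prob_space M" and N: "prob_space N"
    and X: "\<And>n. X n \<in> borel_measurable M" and Z: "Z \<in> borel_measurable N"
    and Z_int: "integrable lborel (cfun (distr N borel Z))"
    and X_int: "\<And>n. n \<ge> m \<Longrightarrow> integrable lborel (cfun (distr M borel (X n)))"
    and L1: "(\<lambda>n. LINT t|lborel. cmod (cfun (distr M borel (X n)) t - cfun (distr N borel Z) t)) \<longlonglongrightarrow> 0"
  shows "(\<lambda>n. renyi_entropy r M (X n)) \<longlonglongrightarrow> renyi_entropy r N Z"
proof -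
  define f where "f n = inv_fourier (cfun (distr M borel (X (n + m))))" for n
  define g where "g = inv_fourier (cfun (distr N borel Z))"
  define e where "e n = (LINT t|lborel. cmod (cfun (distr M borel (X (n + m))) t - cfun (distr N borel Z) t))
     / (2 * pi) ^ DIM('b)" for n
  note G = prob_space.bounded_density_of_integrable_cfun[OF N Z Z_int, folded g_def]
  have F1: "f n \<in> borel_measurable borel" "\<And>x. 0 \<le> f n x"
    "\<And>x. f n x \<le> (LINT t|lborel. cmod (cfun (distr M borel (X (n + m))) t)) / (2 * pi) ^ DIM('b)"
    "distr M borel (X (n + m)) = density lborel (\<lambda>x. ennreal (f n x))" for n
    unfolding f_def by (rule prob_space.bounded_density_of_integrable_cfun[OF M X X_int]; simp)+
  note F2 = bounded_density_entropy[OF M X r F1]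
  note G2 = bounded_density_entropy[OF N Z r G(1-4)]
  have "(\<lambda>n. LINT x|lborel. f n x powr r) \<longlonglongrightarrow> (LINT x|lborel. g x powr r)"
  proof (rule power_integral_tendsto[OF r F2(1) G2(1) F1(2) G(2) G(3)])
    show "(LINT x|lborel. f n x) = (LINT x|lborel. g x)" for n by (simp add: F2(2) G2(2))
    show "\<bar>f n x - g x\<bar> \<le> e n" for n x
      unfolding f_def g_def e_def by (intro inv_fourier_diff_le X_int Z_int) simp
    have "(\<lambda>n. LINT t|lborel. cmod (cfun (distr M borel (X (n + m))) t - cfun (distr N borel Z) t)) \<longlonglongrightarrow> 0"
      using LIMSEQ_ignore_initial_segment[OF L1] .
    from tendsto_divide_zero[OF this] show "e \<longlonglongrightarrow> 0" by (simp add: e_def[abs_def])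
  qed
  then have "(\<lambda>n. ereal (1 / (1 - r) * ln (LINT x|lborel. f n x powr r)))
      \<longlonglongrightarrow> ereal (1 / (1 - r) * ln (LINT x|lborel. g x powr r))"
    using G2(3) by (intro tendsto_ereal tendsto_mult tendsto_const tendsto_ln) auto
  then have "(\<lambda>n. renyi_entropy r M (X (n + m))) \<longlonglongrightarrow> renyi_entropy r N Z"
    by (simp only: F2(4) G2(4))
  then show ?thesis by (rule LIMSEQ_offset)
qed

theorem theorem5:
  fixes r :: real
    and M :: "'a measure" and X :: "nat \<Rightarrow> 'a \<Rightarrow> real ^ 'd"
    and N :: "'b measure" and Z :: "'b \<Rightarrow> real ^ 'd"
  assumes "r > 1"
    and "prob_space M"
    and "prob_space.indep_vars M (\<lambda>_. borel) X {1..}"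
    and "\<And>i. i \<ge> 1 \<Longrightarrow> distr M borel (X i) = distr M borel (X 1)"
    and "centered M (X 1)"
    and "finite_covariance M (X 1)"
    and "prob_space N"
    and "gaussian_vector N Z"
    and "centered N Z"
    and "covariance_matrix N Z = covariance_matrix M (X 1)"
  shows "let
      S1 = ((\<forall>\<^sub>F n in sequentially. has_density M (normalized_sum X n)) \<and> has_density N Z \<and>
            (\<lambda>n. renyi_entropy r M (normalized_sum X n)) \<longlonglongrightarrow> renyi_entropy r N Z);
      S2 = (\<exists>n0\<ge>1. has_density M (normalized_sum X n0) \<and>
            \<bar>renyi_entropy r M (normalized_sum X n0)\<bar> \<noteq> \<infinity>);
      S3 = (\<exists>\<nu>::real. \<nu> \<ge> 1 \<and> (\<integral>\<^sup>+t. ennreal (cmod (char_fun M (X 1) t) powr \<nu>) \<partial>lborel) < \<infinity>);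
      S4 = (\<exists>n0\<ge>1. \<exists>\<rho> C. distributed M lborel (normalized_sum X n0) \<rho> \<and>
            (\<forall>x. \<rho> x \<le> ennreal C))
    in (S1 \<longleftrightarrow> S2) \<and> (S2 \<longleftrightarrow> S3) \<and> (S3 \<longleftrightarrow> S4)"
proof -
  note r = assms(1) and M = assms(2) and indep = assms(3) and law = assms(4) and cent = assms(5)
    and cov = assms(6) and N = assms(7) and gauss = assms(8) and centZ = assms(9) and covZ = assms(10)
  interpret M: prob_space M by fact
  interpret N: prob_space N by fact
  let ?Zn = "normalized_sum X"
  have Zn [measurable]: "?Zn n \<in> borel_measurable M" for n
    by (rule M.normalized_sum_measurable[OF indep])
  have Z [measurable]: "Z \<in> borel_measurable N" using gauss by (simp add: gaussian_vector_def)
  have X1 [measurable]: "X 1 \<in> borel_measurable M"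
    using indep unfolding M.indep_vars_def2 by auto
  note [measurable] = X1[unfolded One_nat_def]
  define \<mu> where "\<mu> = distr M borel (X 1)"
  have mu: "prob_space \<mu>" "sets \<mu> = sets borel" unfolding \<mu>_def using M.prob_space_distr[OF X1] by simp_all
  have law': "distr M borel (X i) = \<mu>" if "i \<ge> 1" for i using law[OF that] by (simp add: \<mu>_def)
  have cf_X: "char_fun M (X 1) = cfun \<mu>" unfolding \<mu>_def by (intro ext M.cfun_distr[symmetric] X1)
  have cf_Zn: "cfun (distr M borel (?Zn n)) t = cfun \<mu> ((1 / sqrt (real n)) *\<^sub>R t) ^ n" for n t
    by (rule M.cfun_normalized_sum[OF indep law'])
  have mu_int: "integrable \<mu> (\<lambda>x. x)"
    unfolding \<mu>_def using cent by (subst integrable_distr_eq) (auto simp: centered_def)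
  have centN: "(LINT \<omega>|N. t \<bullet> Z \<omega>) = 0" for t
    using centZ by (simp add: centered_def integral_inner_right)
  have second: "(LINT \<omega>|N. (t \<bullet> Z \<omega>)\<^sup>2) = (LINT x|\<mu>. (t \<bullet> x)\<^sup>2)" for t
  proof -
    have "(LINT \<omega>|N. (t \<bullet> Z \<omega>)\<^sup>2) = (LINT \<omega>|M. (t \<bullet> X 1 \<omega>)\<^sup>2)"
      unfolding second_moment_covariance(2)[OF N centZ gaussian_finite_covariance[OF N gauss centZ]]
        second_moment_covariance(2)[OF M cent cov] covZ ..
    also have "\<dots> = (LINT x|\<mu>. (t \<bullet> x)\<^sup>2)" unfolding \<mu>_def by (subst integral_distr) auto
    finally show ?thesis .
  qed
  have lim: "(\<lambda>n. cfun \<mu> ((1 / sqrt (real n)) *\<^sub>R t) ^ n) \<longlonglongrightarrow> cfun (distr N borel Z) t" for t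
    unfolding gaussian_linear_functional(2)[OF N gauss centN] second
  proof (rule clt_cfun[OF mu])
    show "integrable \<mu> (\<lambda>x. t \<bullet> x)" using mu_int by simp
    have "(LINT x|\<mu>. t \<bullet> x) = (LINT \<omega>|M. t \<bullet> X 1 \<omega>)" unfolding \<mu>_def by (subst integral_distr) auto
    then show "(LINT x|\<mu>. t \<bullet> x) = 0" using cent by (simp add: centered_def integral_inner_right)
    show "integrable \<mu> (\<lambda>x. (t \<bullet> x)\<^sup>2)" unfolding \<mu>_def
      using second_moment_covariance(1)[OF M cent cov] by (subst integrable_distr_eq) auto
  qed

  define S1 where "S1 \<longleftrightarrow> ((\<forall>\<^sub>F n in sequentially. has_density M (?Zn n)) \<and> has_density N Z \<and>
      (\<lambda>n. renyi_entropy r M (?Zn n)) \<longlonglongrightarrow> renyi_entropy r N Z)"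
  define S2 where "S2 \<longleftrightarrow> (\<exists>n0\<ge>1. has_density M (?Zn n0) \<and> \<bar>renyi_entropy r M (?Zn n0)\<bar> \<noteq> \<infinity>)"
  define S3 where "S3 \<longleftrightarrow> (\<exists>\<nu>::real. \<nu> \<ge> 1 \<and> (\<integral>\<^sup>+t. ennreal (cmod (cfun \<mu> t) powr \<nu>) \<partial>lborel) < \<infinity>)"
  define S4 where "S4 \<longleftrightarrow> (\<exists>n0\<ge>1. \<exists>\<rho> C. distributed M lborel (?Zn n0) \<rho> \<and> (\<forall>x. \<rho> x \<le> ennreal C))"

  have 42: "S2" if S4
  proof -
    from that obtain n \<rho> C where n: "n \<ge> 1" and \<rho>: "distributed M lborel (?Zn n) \<rho>" "\<forall>x. \<rho> x \<le> ennreal C"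
      unfolding S4_def by auto
    have [measurable]: "\<rho> \<in> borel_measurable borel" using \<rho>(1) by (simp add: distributed_def)
    have "renyi_entropy r M (?Zn n) = ereal (1 / (1 - r) * ln (LINT x|lborel. enn2real (\<rho> x) powr r))"
    proof (rule bounded_density_entropy(4)[OF M Zn r])
      show "enn2real (\<rho> x) \<le> max 0 C" for x
        using spec[OF \<rho>(2), of x] by (intro enn2real_leI) (auto simp: max_def ennreal_neg split: if_splits)
    qed (auto intro: M.distributed_real_density[OF \<rho>(1)])
    then show S2 unfolding S2_def has_density_def using n \<rho>(1) by auto
  qed
  have 23: "S3" if S2
  proof -
    from that obtain n where n: "n \<ge> 1" and D: "has_density M (?Zn n)"
      and fin: "\<bar>renyi_entropy r M (?Zn n)\<bar> \<noteq> \<infinity>"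
      unfolding S2_def by auto
    obtain \<rho> where \<rho>: "distributed M lborel (?Zn n) \<rho>"
      using D unfolding has_density_def by auto
    have [measurable]: "\<rho> \<in> borel_measurable borel" using \<rho> by (simp add: distributed_def)
    note dens = M.distributed_real_density[OF \<rho>]
    have "(\<integral>\<^sup>+x. ennreal (enn2real (\<rho> x) powr r) \<partial>lborel) < \<infinity>"
      using fin by (intro power_integral_finite_if_renyi_finite[OF r])
        (simp add: renyi_entropy_eq_log_power_integral[OF _ _ dens])
    then show S3 unfolding S3_def
      using M.power_integrable_density_imp_power_integrable_cfun[OF indep law' n r _ dens] by auto
  qed
  have 314: "S1 \<and> S4" if S3
  proof -
    from that obtain \<nu> :: real where nu: "\<nu> \<ge> 1"
      and fin: "(\<integral>\<^sup>+t. ennreal (cmod (cfun \<mu> t) powr \<nu>) \<partial>lborel) < \<infinity>"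
      unfolding S3_def by blast
    have nu0: "\<nu> \<ge> 0" using nu by simp
    note L = local_limit_L1[OF mu mu_int nu0 fin lim]
    define m where "m = nat \<lceil>\<nu>\<rceil>"
    have m: "n > 0 \<and> real n \<ge> \<nu>" if "n \<ge> m" for n
    proof -
      have "real n \<ge> \<nu>" using that unfolding m_def by (simp add: nat_ceiling_le_eq)
      then show ?thesis using nu by (cases n) auto
    qed
    have int_n: "integrable lborel (cfun (distr M borel (?Zn n)))" if "n \<ge> m" for n
      unfolding cf_Zn[abs_def] using L(2)[of n] m[OF that] by simp
    have int_Z: "integrable lborel (cfun (distr N borel Z))" using L(1) by simp
    have "has_density M (?Zn n)" if "n \<ge> m" for n
      using M.bounded_density_of_integrable_cfun(5)[OF Zn int_n[OF that]] by (auto simp: has_density_def)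
    moreover have "has_density N Z"
      using N.bounded_density_of_integrable_cfun(5)[OF Z int_Z] by (auto simp: has_density_def)
    moreover have "(\<lambda>n. renyi_entropy r M (?Zn n)) \<longlonglongrightarrow> renyi_entropy r N Z"
      by (rule entropy_convergence_of_integrable_cfun[OF r M N Zn Z int_Z int_n]) (use L(3) cf_Zn in auto)
    ultimately have S1 unfolding S1_def by (auto intro: eventually_sequentiallyI[of m])
    moreover have S4 unfolding S4_def
      using M.bounded_density_of_integrable_cfun(3,5)[OF Zn int_n[OF order_refl]] m[OF order_refl]
      by (intro exI[of _ m] conjI exI[of _ "\<lambda>x. ennreal (inv_fourier (cfun (distr M borel (?Zn m))) x)"]
          exI[of _ "(LINT t|lborel. cmod (cfun (distr M borel (?Zn m)) t)) / (2 * pi) ^ DIM(real ^ 'd)"]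
          allI ennreal_leI) auto
    ultimately show ?thesis ..
  qed
  have 12: "S2" if S1
  proof -
    from that have ev: "\<forall>\<^sub>F n in sequentially. has_density M (?Zn n)" and dens: "has_density N Z"
      and conv: "(\<lambda>n. renyi_entropy r M (?Zn n)) \<longlonglongrightarrow> renyi_entropy r N Z"
      unfolding S1_def by auto
    have int_Z: "integrable lborel (cfun (distr N borel Z))"
      by (rule gaussian_density_imp_integrable_cfun[OF N gauss centZ dens])
    obtain h where h: "renyi_entropy r N Z = ereal h"
      using bounded_density_entropy(4)[OF N Z r N.bounded_density_of_integrable_cfun(1-4)[OF Z int_Z]] by blast
    have "\<forall>\<^sub>F n in sequentially. ereal (h - 1) < renyi_entropy r M (?Zn n)"
      "\<forall>\<^sub>F n in sequentially. renyi_entropy r M (?Zn n) < ereal (h + 1)"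
      using conv unfolding h by (auto intro: order_tendstoD)
    with ev eventually_ge_at_top[of "1::nat"]
    have "\<forall>\<^sub>F n in sequentially. n \<ge> 1 \<and> has_density M (?Zn n) \<and> \<bar>renyi_entropy r M (?Zn n)\<bar> \<noteq> \<infinity>"
    proof eventually_elim
      case (elim n)
      then show ?case by (cases "renyi_entropy r M (?Zn n)") auto
    qed
    from eventually_happens'[OF sequentially_bot this] show S2 unfolding S2_def by auto
  qed
  have "(S1 \<longleftrightarrow> S2) \<and> (S2 \<longleftrightarrow> S3) \<and> (S3 \<longleftrightarrow> S4)"
    using 12 23 314 42 by blast
  then show ?thesis
    unfolding Let_def cf_X S1_def S2_def S3_def S4_def .
qed

end
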